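(* Let $S=\bigcup_{e\in E(S)}G_e$ be a Clifford semigroup such that $E(S)$ is uniformly locally finite. Then $\ell^1(S)$ is approximately left character biprojective if and only if $\ell^1(S)$ is pseudo-amenable.
   Context: $E(S)$ is the set of idempotents of $S$. $S$ is an inverse semigroup if each $s\in S$ has $s^*\in S$ with $ss^*s=s$ and $s^*ss^*=s^*$; it is Clifford if moreover $ss^*=s^*s$ for all $s$. The partial order is $s\le t\iff s=ss^*t$; for $x\in S$, $(x]=\{y\in S:y\le x\}$, and $E(S)$ is uniformly locally finite if $\sup\{|(x]|:x\in E(S)\}<\infty$. For $e\in E(S)$, $G_e=\{s\in S:ss^*=s^*s=e\}$. $\ell^1(S)$ is the semigroup algebra with convolution. For a Banach algebra $A$, $\Delta(A)$ is its character set; $A\otimes_pA$ is the projective tensor product with $a\cdot(b\otimes c)=ab\otimes c$, $(b\otimes c)\cdot a=b\otimes ca$, $\pi_A(a\otimes b)=ab$. For $\phi\in\Delta(A)$, $A$ is approximately left $\phi$-biprojective if there is a net $(\rho_\alpha)$ of bounded linear maps $A\to A\otimes_pA$ such that for all $a,x\in A$: $\|a\cdot\rho_\alpha(x)-\rho_\alpha(ax)\|\to0$, $\|\rho_\alpha(xa)-\phi(a)\rho_\alpha(x)\|\to0$, $\phi(\pi_A(\rho_\alpha(x)))-\phi(x)\to0$; $A$ is approximately left character biprojective if this holds for every $\phi\in\Delta(A)$. $A$ is pseudo-amenable if there is a (not necessarily bounded) net $(m_\alpha)$ in $A\otimes_pA$ with $a\cdot m_\alpha-m_\alpha\cdot a\to0$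 and $\pi_A(m_\alpha)a\to a$ for all $a\in A$. *)

theory Defs
  imports "HOL-Analysis.Analysis"
begin

text \<open>The semigroup S is the whole type 'a (class semigroup_mult); the inversion s |-> s^* is
  passed as a function star.  An inverse semigroup: every s has an inverse, and it is unique.\<close>

definition inverse_semigroup :: "('a::semigroup_mult \<Rightarrow> 'a) \<Rightarrow> bool" where
  "inverse_semigroup star \<longleftrightarrow>
     (\<forall>s. s * star s * s = s \<and> star s * s * star s = star s) \<and>
     (\<forall>s t. s * t * s = s \<and> t * s * t = t \<longrightarrow> t = star s)"

definition clifford_semigroup :: "('a::semigroup_mult \<Rightarrow> 'a) \<Rightarrow> bool" where
  "clifford_semigroup star \<longleftrightarrow> inverse_semigroup star \<and> (\<forall>s. s * star s = star s * s)"

definition idempotents :: "'a::semigroup_mult set" where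
  "idempotents = {e. e * e = e}"

definition sg_le :: "('a::semigroup_mult \<Rightarrow> 'a) \<Rightarrow> 'a \<Rightarrow> 'a \<Rightarrow> bool" where
  "sg_le star s t \<longleftrightarrow> s = s * star s * t"

definition down_set :: "('a::semigroup_mult \<Rightarrow> 'a) \<Rightarrow> 'a \<Rightarrow> 'a set" where
  "down_set star x = {y. sg_le star y x}"

definition uniformly_locally_finite :: "('a::semigroup_mult \<Rightarrow> 'a) \<Rightarrow> bool" where
  "uniformly_locally_finite star \<longleftrightarrow>
     (\<exists>N::nat. \<forall>x\<in>idempotents. finite (down_set star x) \<and> card (down_set star x) \<le> N)"

definition l1 :: "('b \<Rightarrow> complex) set" where
  "l1 = {f. (\<lambda>x. norm (f x)) summable_on UNIV}"

definition l1norm :: "('b \<Rightarrow> complex) \<Rightarrow> real" where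
  "l1norm f = infsum (\<lambda>x. norm (f x)) UNIV"

definition conv :: "('a::semigroup_mult \<Rightarrow> complex) \<Rightarrow> ('a \<Rightarrow> complex) \<Rightarrow> 'a \<Rightarrow> complex" where
  "conv f g s = infsum (\<lambda>(x, y). f x * g y) {(x, y). x * y = s}"

text \<open>l^1(S) \<otimes>_p l^1(S) is identified (isometrically, as Banach l^1(S)-bimodule) with l^1(S \<times> S),
  via delta_x \<otimes> delta_y |-> delta_(x,y).\<close>

definition lact :: "('a::semigroup_mult \<Rightarrow> complex) \<Rightarrow> ('a \<times> 'a \<Rightarrow> complex) \<Rightarrow> 'a \<times> 'a \<Rightarrow> complex" where
  "lact a m = (\<lambda>(u, v). infsum (\<lambda>(x, w). a x * m (w, v)) {(x, w). x * w = u})"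

definition ract :: "('a \<times> 'a \<Rightarrow> complex) \<Rightarrow> ('a::semigroup_mult \<Rightarrow> complex) \<Rightarrow> 'a \<times> 'a \<Rightarrow> complex" where
  "ract m a = (\<lambda>(u, v). infsum (\<lambda>(w, y). m (u, w) * a y) {(w, y). w * y = v})"

definition diag_pi :: "('a::semigroup_mult \<times> 'a \<Rightarrow> complex) \<Rightarrow> 'a \<Rightarrow> complex" where
  "diag_pi m s = infsum (\<lambda>(u, v). m (u, v)) {(u, v). u * v = s}"

definition character :: "(('a::semigroup_mult \<Rightarrow> complex) \<Rightarrow> complex) \<Rightarrow> bool" where
  "character \<phi> \<longleftrightarrow>
     (\<forall>f\<in>l1. \<forall>g\<in>l1. \<phi> (\<lambda>s. f s + g s) = \<phi> f + \<phi> g) \<and>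
     (\<forall>c. \<forall>f\<in>l1. \<phi> (\<lambda>s. c * f s) = c * \<phi> f) \<and>
     (\<exists>C. \<forall>f\<in>l1. norm (\<phi> f) \<le> C * l1norm f) \<and>
     (\<forall>f\<in>l1. \<forall>g\<in>l1. \<phi> (conv f g) = \<phi> f * \<phi> g) \<and>
     (\<exists>f\<in>l1. \<phi> f \<noteq> 0)"

definition bounded_linear_l1 :: "(('b \<Rightarrow> complex) \<Rightarrow> ('c \<Rightarrow> complex)) \<Rightarrow> bool" where
  "bounded_linear_l1 \<rho> \<longleftrightarrow>
     (\<forall>f\<in>l1. \<rho> f \<in> l1) \<and>
     (\<forall>f\<in>l1. \<forall>g\<in>l1. \<rho> (\<lambda>s. f s + g s) = (\<lambda>p. \<rho> f p + \<rho> g p)) \<and>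
     (\<forall>c. \<forall>f\<in>l1. \<rho> (\<lambda>s. c * f s) = (\<lambda>p. c * \<rho> f p)) \<and>
     (\<exists>C. \<forall>f\<in>l1. l1norm (\<rho> f) \<le> C * l1norm f)"

text \<open>Nets are represented by (proper) filters on the space of values, the standard HOL idiom.\<close>

definition approx_left_phi_biprojective ::
  "(('a::semigroup_mult \<Rightarrow> complex) \<Rightarrow> complex) \<Rightarrow> bool" where
  "approx_left_phi_biprojective \<phi> \<longleftrightarrow>
     (\<exists>F :: (('a \<Rightarrow> complex) \<Rightarrow> ('a \<times> 'a \<Rightarrow> complex)) filter.
        F \<noteq> bot \<and> (\<forall>\<^sub>F \<rho> in F. bounded_linear_l1 \<rho>) \<and>
        (\<forall>a\<in>l1. \<forall>x\<in>l1.
           ((\<lambda>\<rho>. l1norm (\<lambda>p. lact a (\<rho> x) p - \<rho> (conv a x) p)) \<longlongrightarrow> 0) F \<and>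
           ((\<lambda>\<rho>. l1norm (\<lambda>p. \<rho> (conv x a) p - \<phi> a * \<rho> x p)) \<longlongrightarrow> 0) F \<and>
           ((\<lambda>\<rho>. \<phi> (diag_pi (\<rho> x)) - \<phi> x) \<longlongrightarrow> 0) F))"

definition approx_left_character_biprojective :: "('a::semigroup_mult \<Rightarrow> 'a) \<Rightarrow> bool" where
  "approx_left_character_biprojective (star :: 'a \<Rightarrow> 'a) \<longleftrightarrow>
     (\<forall>\<phi> :: ('a \<Rightarrow> complex) \<Rightarrow> complex. character \<phi> \<longrightarrow> approx_left_phi_biprojective \<phi>)"

definition pseudo_amenable :: "('a::semigroup_mult \<Rightarrow> 'a) \<Rightarrow> bool" where
  "pseudo_amenable (star :: 'a \<Rightarrow> 'a) \<longleftrightarrow>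
     (\<exists>F :: ('a \<times> 'a \<Rightarrow> complex) filter.
        F \<noteq> bot \<and> (\<forall>\<^sub>F m in F. m \<in> l1) \<and>
        (\<forall>a\<in>l1.
           ((\<lambda>m. l1norm (\<lambda>p. lact a m p - ract m a p)) \<longlongrightarrow> 0) F \<and>
           ((\<lambda>m. l1norm (\<lambda>s. conv (diag_pi m) a s - a s)) \<longlongrightarrow> 0) F))"

end

theory Submission
  imports Defs "HOL-Library.Function_Algebras"
begin

text \<open>
  If \<open>(m\<^sub>\<alpha>)\<close> is an approximate diagonal and \<open>\<phi>\<close> a character with \<open>\<phi>(b) = 1\<close>, then the rank one maps
  \<open>x \<mapsto> \<phi>(x) ((id \<otimes> \<phi>)(m\<^sub>\<alpha>) \<otimes> b)\<close> witness approximate left \<open>\<phi>\<close>-biprojectivity; this direction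
  holds in every Banach algebra.

  Conversely, for \<open>e \<in> E(S)\<close> the functional \<open>\<phi>\<^sub>e(f) = \<Sum>\<^bsub>ss\<^sup>* \<ge> e\<^esub> f(s)\<close> is a character, and approximate
  left \<open>\<phi>\<^sub>e\<close>-biprojectivity evaluated at \<open>\<delta>\<^sub>e\<close> yields Reiter's condition for the group \<open>G\<^sub>e\<close>. Since
  \<open>E(S)\<close> is uniformly locally finite, \<open>\<ell>\<^sup>1(S)\<close> is the \<open>\<ell>\<^sup>1\<close>-sum of the algebras \<open>\<ell>\<^sup>1(G\<^sub>e)\<close>, embedded through
  the central idempotents \<open>P\<^sub>e = \<Sum>\<^bsub>f \<le> e\<^esub> \<mu>(f, e) \<delta>\<^sub>f\<close>, which are uniformly bounded. Transporting the
  approximate diagonals of finitely many \<open>\<ell>\<^sup>1(G\<^sub>e)\<close> by \<open>P\<^sub>e\<close> and adding them up gives elements \<open>m\<close> such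
  that \<open>\<delta>\<^sub>s \<cdot> m - m \<cdot> \<delta>\<^sub>s\<close> and \<open>\<pi>(m) \<delta>\<^sub>s - \<delta>\<^sub>s\<close> are bounded uniformly in \<open>s\<close> and small for the \<open>s\<close> of a
  prescribed finite set.
\<close>

section \<open>Absolutely summable functions and push-forwards\<close>

lemma l1D: "f \<in> l1 \<Longrightarrow> (\<lambda>x. norm (f x)) summable_on A"
  unfolding l1_def by (auto intro: summable_on_subset_banach)

lemma l1_summable: "f \<in> l1 \<Longrightarrow> f summable_on A"
  using l1D abs_summable_summable by blast

lemma l1I: "f summable_on UNIV \<Longrightarrow> f \<in> l1"
  unfolding l1_def by (simp add: summable_on_iff_abs_summable_on_complex)

lemma l1_comparison:
  assumes "g summable_on UNIV" "\<And>x. norm (f x) \<le> g x"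
  shows "f \<in> l1" "l1norm f \<le> infsum g UNIV"
proof -
  show "f \<in> l1"
    unfolding l1_def using assms Infinite_Sum.abs_summable_on_comparison_test' by blast
  then show "l1norm f \<le> infsum g UNIV"
    unfolding l1norm_def by (intro infsum_mono assms l1D)
qed

lemma l1norm_nonneg [simp]: "0 \<le> l1norm f"
  unfolding l1norm_def by (intro infsum_nonneg) simp

lemma norm_infsum_le_l1norm:
  assumes "f \<in> l1"
  shows "norm (infsum f A) \<le> l1norm f"
proof -
  have "norm (infsum f A) \<le> infsum (\<lambda>x. norm (f x)) A"
    using assms by (intro norm_infsum_bound l1D)
  also have "\<dots> \<le> l1norm f"
    unfolding l1norm_def using assms by (intro infsum_mono2 l1D) auto
  finally show ?thesis .
qed

lemma l1_zero [simp]: "0 \<in> l1"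
  by (simp add: l1_def)

lemma l1norm_zero [simp]: "l1norm 0 = 0"
  by (simp add: l1norm_def)

lemma l1_add [simp]: "f \<in> l1 \<Longrightarrow> g \<in> l1 \<Longrightarrow> f + g \<in> l1"
  unfolding plus_fun_def by (rule l1I, rule summable_on_add) (simp_all add: l1_summable)

lemma l1norm_add:
  assumes "f \<in> l1" "g \<in> l1"
  shows "l1norm (f + g) \<le> l1norm f + l1norm g"
proof -
  have "l1norm (f + g) \<le> infsum (\<lambda>x. norm (f x) + norm (g x)) UNIV"
    by (rule l1_comparison(2)) (use assms in \<open>simp_all add: norm_triangle_ineq summable_on_add l1D\<close>)
  also have "\<dots> = l1norm f + l1norm g"
    unfolding l1norm_def using assms by (intro infsum_add l1D)
  finally show ?thesis .
qed

lemma l1_cmult [simp]: "f \<in> l1 \<Longrightarrow> (\<lambda>x. c * f x) \<in> l1"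
  by (rule l1I) (simp add: summable_on_cmult_right l1_summable)

lemma l1norm_cmult: "l1norm (\<lambda>x. c * f x) = norm c * l1norm f"
  by (simp add: l1norm_def norm_mult infsum_cmult_right')

lemma l1_uminus [simp]: "f \<in> l1 \<Longrightarrow> - f \<in> l1"
  by (simp add: l1_def)

lemma l1norm_uminus [simp]: "l1norm (- f) = l1norm f"
  by (simp add: l1norm_def)

lemma l1_diff [simp]: "f \<in> l1 \<Longrightarrow> g \<in> l1 \<Longrightarrow> f - g \<in> l1"
  using l1_add[of f "- g"] by simp

lemma l1norm_diff: "f \<in> l1 \<Longrightarrow> g \<in> l1 \<Longrightarrow> l1norm (f - g) \<le> l1norm f + l1norm g"
  using l1norm_add[of f "- g"] by simp

lemma l1_sum: "(\<And>i. i \<in> I \<Longrightarrow> f i \<in> l1) \<Longrightarrow> sum f I \<in> l1"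
  by (induction I rule: infinite_finite_induct) auto

lemma l1norm_sum:
  "(\<And>i. i \<in> I \<Longrightarrow> f i \<in> l1) \<Longrightarrow> l1norm (sum f I) \<le> (\<Sum>i\<in>I. l1norm (f i))"
proof (induction I rule: infinite_finite_induct)
  case (insert i I)
  then have "l1norm (f i + sum f I) \<le> l1norm (f i) + l1norm (sum f I)"
    by (intro l1norm_add l1_sum) auto
  also have "\<dots> \<le> l1norm (f i) + (\<Sum>i\<in>I. l1norm (f i))"
    using insert by simp
  finally show ?case unfolding sum.insert[OF insert.hyps] .
qed auto

lemma l1_mult_bounded:
  assumes "f \<in> l1" "\<forall>x. norm (\<psi> x) \<le> C"
  shows "(\<lambda>x. \<psi> x * f x) \<in> l1" "l1norm (\<lambda>x. \<psi> x * f x) \<le> C * l1norm f"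
proof -
  have *: "(\<lambda>x. C * norm (f x)) summable_on UNIV"
    using assms by (intro summable_on_cmult_right l1D)
  have **: "norm (\<psi> x * f x) \<le> C * norm (f x)" for x
    using assms by (simp add: norm_mult mult_right_mono)
  show "(\<lambda>x. \<psi> x * f x) \<in> l1" using l1_comparison(1)[OF * **] .
  show "l1norm (\<lambda>x. \<psi> x * f x) \<le> C * l1norm f"
    using l1_comparison(2)[OF * **] by (simp add: l1norm_def infsum_cmult_right')
qed

section \<open>Point masses and push-forwards along maps\<close>

definition delta :: "'b \<Rightarrow> 'b \<Rightarrow> complex" where
  "delta s = (\<lambda>t. if t = s then 1 else 0)"

lemma infsum_single:
  assumes "\<And>t. t \<in> A \<Longrightarrow> t \<noteq> s \<Longrightarrow> f t = 0"
  shows "infsum f A = (if s \<in> A then f s else 0)"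
proof -
  have "infsum f A = infsum f (A \<inter> {s})"
    using assms by (intro infsum_cong_neutral) auto
  then show ?thesis by auto
qed

lemma delta_l1 [simp]: "delta s \<in> l1"
  unfolding l1_def delta_def
  by (simp, rule finite_nonzero_values_imp_summable_on) simp

lemma l1norm_delta [simp]: "l1norm (delta s) = 1"
  unfolding l1norm_def delta_def by (subst infsum_single[of _ s]) auto

lemma infsum_delta: "infsum (\<lambda>t. f t * delta s t) UNIV = f s"
  unfolding delta_def by (subst infsum_single[of _ s]) auto

text \<open>Convolution, the module actions and the product map are all push-forwards of tensor
  products. Algebraic identities between them then reduce to equalities of composed maps, with the
  rearrangement of infinite sums done once in \<open>push_push\<close>.\<close>

definition push :: "('b \<Rightarrow> 'c) \<Rightarrow> ('b \<Rightarrow> complex) \<Rightarrow> 'c \<Rightarrow> complex" where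
  "push f h t = infsum h {p. f p = t}"

lemma Sigma_fibres: "bij_betw snd (Sigma T (\<lambda>t. {p. f p = t})) (f -` T)"
  by (rule bij_betwI[where g = "\<lambda>p. (f p, p)"]) auto

lemma infsum_fibres:
  fixes h :: "'b \<Rightarrow> 'd::banach"
  assumes "h summable_on UNIV"
  shows "infsum (\<lambda>t. infsum h {p. f p = t}) T = infsum h (f -` T)"
    "(\<lambda>t. infsum h {p. f p = t}) summable_on T"
proof -
  have "h summable_on (f -` T)"
    using assms by (rule summable_on_subset_banach) auto
  then have *: "(\<lambda>q. h (snd q)) summable_on (Sigma T (\<lambda>t. {p. f p = t}))"
    using summable_on_reindex_bij_betw[OF Sigma_fibres[of T f], of h] by simp
  show "infsum (\<lambda>t. infsum h {p. f p = t}) T = infsum h (f -` T)"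
    using infsum_Sigma_banach[OF *] infsum_reindex_bij_betw[OF Sigma_fibres[of T f], of h] by simp
  show "(\<lambda>t. infsum h {p. f p = t}) summable_on T"
    using summable_on_Sigma_banach[of "\<lambda>_ p. h p"] * by (simp add: case_prod_unfold)
qed

lemma infsum_push: "h \<in> l1 \<Longrightarrow> infsum (push f h) T = infsum h (f -` T)"
  unfolding push_def by (intro infsum_fibres l1_summable)

lemma
  assumes "h \<in> l1"
  shows push_l1 [simp]: "push f h \<in> l1" and l1norm_push: "l1norm (push f h) \<le> l1norm h"
proof -
  have *: "(\<lambda>p. norm (h p)) summable_on UNIV" using assms by (rule l1D)
  have **: "norm (push f h t) \<le> infsum (\<lambda>p. norm (h p)) {p. f p = t}" for t
    unfolding push_def using assms by (intro norm_infsum_bound l1D)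
  show "push f h \<in> l1" by (rule l1_comparison(1)[OF infsum_fibres(2)[OF *] **])
  show "l1norm (push f h) \<le> l1norm h"
    using l1_comparison(2)[OF infsum_fibres(2)[OF *] **] infsum_fibres(1)[OF *, of f UNIV]
    by (simp add: l1norm_def)
qed

lemma push_push: "h \<in> l1 \<Longrightarrow> push g (push f h) = push (\<lambda>p. g (f p)) h"
  by (rule ext, subst push_def) (simp add: infsum_push, simp add: push_def vimage_def)

text \<open>The weight is constant on each fibre, and scaling by a constant commutes with
  \<open>infsum\<close> whether or not the fibre sum converges.\<close>

lemma push_mult: "push f (\<lambda>p. \<psi> (f p) * h p) = (\<lambda>t. \<psi> t * push f h t)"
proof
  fix t
  have "push f (\<lambda>p. \<psi> (f p) * h p) t = infsum (\<lambda>p. \<psi> t * h p) {p. f p = t}"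
    unfolding push_def by (intro infsum_cong) auto
  then show "push f (\<lambda>p. \<psi> (f p) * h p) t = \<psi> t * push f h t"
    by (simp add: push_def infsum_cmult_right')
qed

lemma push_cong:
  assumes "\<And>p. h p \<noteq> 0 \<Longrightarrow> f p = g p"
  shows "push f h = push g h"
  unfolding push_def by (intro ext infsum_cong_neutral) (use assms in force)+

lemma push_add: "h \<in> l1 \<Longrightarrow> k \<in> l1 \<Longrightarrow> push f (h + k) = push f h + push f k"
  unfolding push_def by (auto simp: plus_fun_def intro!: infsum_add l1_summable)

lemma push_cmult: "push f (\<lambda>p. c * h p) = (\<lambda>t. c * push f h t)"
  unfolding push_def by (simp add: infsum_cmult_right')

lemma push_uminus: "push f (- h) = - push f h"
  using push_cmult[of f "-1" h] by (simp add: fun_Compl_def)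

lemma push_diff: "h \<in> l1 \<Longrightarrow> k \<in> l1 \<Longrightarrow> push f (h - k) = push f h - push f k"
  using push_add[of h "- k" f] by (simp add: push_uminus)

lemma push_delta [simp]: "push f (delta s) = delta (f s)"
proof
  fix t show "push f (delta s) t = delta (f s) t"
    unfolding push_def delta_def by (subst infsum_single[of _ s]) auto
qed

section \<open>Elementary tensors as functions on a product\<close>

definition tensor :: "('b \<Rightarrow> complex) \<Rightarrow> ('c \<Rightarrow> complex) \<Rightarrow> 'b \<times> 'c \<Rightarrow> complex" where
  "tensor a b = (\<lambda>(x, y). a x * b y)"

lemma
  assumes "a \<in> l1" "b \<in> l1"
  shows tensor_l1 [simp]: "tensor a b \<in> l1"
    and l1norm_tensor: "l1norm (tensor a b) = l1norm a * l1norm b"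
    and infsum_tensor: "infsum (tensor a b) UNIV = infsum a UNIV * infsum b UNIV"
proof -
  have "(\<lambda>p. norm (tensor a b p)) summable_on (UNIV \<times> UNIV)"
    unfolding Infinite_Sum.abs_summable_on_Sigma_iff
    using assms by (auto simp: tensor_def norm_mult infsum_cmult_right' infsum_nonneg abs_mult
        intro!: summable_on_cmult_right summable_on_cmult_left l1D)
  then have *: "(\<lambda>p. norm (tensor a b p)) summable_on UNIV" by simp
  show "tensor a b \<in> l1"
    using * by (simp add: l1_def)
  then have "tensor a b summable_on UNIV" by (rule l1_summable)
  then show "infsum (tensor a b) UNIV = infsum a UNIV * infsum b UNIV"
    using infsum_Sigma_banach[of "tensor a b" UNIV "\<lambda>_. UNIV"]
    by (simp add: tensor_def infsum_cmult_right' infsum_cmult_left')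
  show "l1norm (tensor a b) = l1norm a * l1norm b"
    using * infsum_Sigma_banach[of "\<lambda>p. norm (tensor a b p)" UNIV "\<lambda>_. UNIV"]
    by (simp add: l1norm_def tensor_def norm_mult infsum_cmult_right' infsum_cmult_left')
qed

lemma tensor_delta: "tensor (delta x) (delta y) = delta (x, y)"
  by (auto simp: tensor_def delta_def)

lemma tensor_push_right: "tensor a (push f h) = push (\<lambda>(x, p). (x, f p)) (tensor a h)"
proof (intro ext, clarify)
  fix x t
  have "push (\<lambda>(x, p). (x, f p)) (tensor a h) (x, t) = infsum (tensor a h) (Pair x ` {p. f p = t})"
    unfolding push_def by (rule arg_cong[of _ _ "infsum _"]) auto
  also have "\<dots> = tensor a (push f h) (x, t)"
    by (subst infsum_reindex) (auto simp: inj_on_def o_def tensor_def push_def infsum_cmult_right')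
  finally show "tensor a (push f h) (x, t) = push (\<lambda>(x, p). (x, f p)) (tensor a h) (x, t)" ..
qed

lemma tensor_swap: "tensor a b = push (\<lambda>(y, x). (x, y)) (tensor b a)"
proof (intro ext, clarify)
  fix x y
  have "push (\<lambda>(y, x). (x, y)) (tensor b a) (x, y) = infsum (tensor b a) {(y, x)}"
    unfolding push_def by (rule arg_cong[of _ _ "infsum _"]) auto
  then show "tensor a b (x, y) = push (\<lambda>(y, x). (x, y)) (tensor b a) (x, y)"
    by (simp add: tensor_def)
qed

lemma tensor_push_left:
  assumes "a \<in> l1" "h \<in> l1"
  shows "tensor (push f h) a = push (\<lambda>(p, x). (f p, x)) (tensor h a)"
proof -
  have "tensor (push f h) a = push (\<lambda>(p, x). (f x, p)) (tensor a h)"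
    using assms by (subst tensor_swap) (simp add: tensor_push_right push_push case_prod_unfold)
  also have "\<dots> = push (\<lambda>(p, x). (f p, x)) (tensor h a)"
    using assms by (subst tensor_swap[of h a]) (simp add: push_push case_prod_unfold)
  finally show ?thesis .
qed

lemma tensor_assoc: "tensor (tensor a b) c = push (\<lambda>(x, y, z). ((x, y), z)) (tensor a (tensor b c))"
proof (intro ext, clarify)
  fix x y z
  have "push (\<lambda>(x, y, z). ((x, y), z)) (tensor a (tensor b c)) ((x, y), z) =
      infsum (tensor a (tensor b c)) {(x, y, z)}"
    unfolding push_def by (rule arg_cong[of _ _ "infsum _"]) auto
  then show "tensor (tensor a b) c ((x, y), z) =
      push (\<lambda>(x, y, z). ((x, y), z)) (tensor a (tensor b c)) ((x, y), z)"
    by (simp add: tensor_def)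
qed

lemma tensor_add_left: "tensor (a + b) c = tensor a c + tensor b c"
  by (auto simp: tensor_def algebra_simps)

lemma tensor_add_right: "tensor c (a + b) = tensor c a + tensor c b"
  by (auto simp: tensor_def algebra_simps)

lemma tensor_cmult_left: "tensor (\<lambda>x. k * a x) c = (\<lambda>p. k * tensor a c p)"
  by (auto simp: tensor_def algebra_simps)

lemma tensor_cmult_right: "tensor c (\<lambda>x. k * a x) = (\<lambda>p. k * tensor c a p)"
  by (auto simp: tensor_def algebra_simps)

section \<open>Convolution, bimodule actions and product map as push-forwards\<close>

lemma conv_push: "conv a b = push (\<lambda>(x, y). x * y) (tensor a b)"
  unfolding conv_def push_def tensor_def
  by (intro ext arg_cong2[of _ _ _ _ infsum]) auto

lemma diag_pi_push: "diag_pi m = push (\<lambda>(x, y). x * y) m"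
  unfolding diag_pi_def push_def
  by (intro ext arg_cong2[of _ _ _ _ infsum]) auto

lemma lact_push:
  fixes a :: "'a::semigroup_mult \<Rightarrow> complex"
  shows "lact a m = push (\<lambda>(x, w, v). (x * w, v)) (tensor a m)"
proof (intro ext, clarify)
  fix u v :: 'a
  have "{(x, w, v'). (x * w, v') = (u, v)} = (\<lambda>(x, w). (x, w, v)) ` {(x, w). x * w = u}"
    by auto
  then have "push (\<lambda>(x, w, v). (x * w, v)) (tensor a m) (u, v) =
      infsum (tensor a m) ((\<lambda>(x, w). (x, w, v)) ` {(x, w). x * w = u})"
    by (simp add: push_def case_prod_unfold)
  also have "\<dots> = lact a m (u, v)"
    by (subst infsum_reindex)
      (auto simp: inj_on_def o_def tensor_def lact_def case_prod_unfold)
  finally show "lact a m (u, v) = push (\<lambda>(x, w, v). (x * w, v)) (tensor a m) (u, v)" ..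
qed

lemma ract_push:
  fixes a :: "'a::semigroup_mult \<Rightarrow> complex"
  shows "ract m a = push (\<lambda>((u, w), y). (u, w * y)) (tensor m a)"
proof (intro ext, clarify)
  fix u v :: 'a
  have "{((u', w), y). (u', w * y) = (u, v)} = (\<lambda>(w, y). ((u, w), y)) ` {(w, y). w * y = v}"
    by auto
  then have "push (\<lambda>((u, w), y). (u, w * y)) (tensor m a) (u, v) =
      infsum (tensor m a) ((\<lambda>(w, y). ((u, w), y)) ` {(w, y). w * y = v})"
    by (simp add: push_def case_prod_unfold)
  also have "\<dots> = ract m a (u, v)"
    by (subst infsum_reindex)
      (auto simp: inj_on_def o_def tensor_def ract_def case_prod_unfold)
  finally show "ract m a (u, v) = push (\<lambda>((u, w), y). (u, w * y)) (tensor m a) (u, v)" ..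
qed

lemma conv_l1 [simp]: "a \<in> l1 \<Longrightarrow> b \<in> l1 \<Longrightarrow> conv a b \<in> l1"
  by (simp add: conv_push)

lemma lact_l1 [simp]: "a \<in> l1 \<Longrightarrow> m \<in> l1 \<Longrightarrow> lact a m \<in> l1"
  by (simp add: lact_push)

lemma ract_l1 [simp]: "a \<in> l1 \<Longrightarrow> m \<in> l1 \<Longrightarrow> ract m a \<in> l1"
  by (simp add: ract_push)

lemma diag_pi_l1 [simp]: "m \<in> l1 \<Longrightarrow> diag_pi m \<in> l1"
  by (simp add: diag_pi_push)

lemma l1norm_push_tensor:
  "a \<in> l1 \<Longrightarrow> b \<in> l1 \<Longrightarrow> l1norm (push f (tensor a b)) \<le> l1norm a * l1norm b"
  using l1norm_push[of "tensor a b" f] by (simp add: l1norm_tensor)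

lemma l1norm_conv: "a \<in> l1 \<Longrightarrow> b \<in> l1 \<Longrightarrow> l1norm (conv a b) \<le> l1norm a * l1norm b"
  by (simp add: conv_push l1norm_push_tensor)

lemma l1norm_lact: "a \<in> l1 \<Longrightarrow> m \<in> l1 \<Longrightarrow> l1norm (lact a m) \<le> l1norm a * l1norm m"
  by (simp add: lact_push l1norm_push_tensor)

lemma l1norm_ract: "a \<in> l1 \<Longrightarrow> m \<in> l1 \<Longrightarrow> l1norm (ract m a) \<le> l1norm m * l1norm a"
  by (simp add: ract_push l1norm_push_tensor)

text \<open>Here and in the next identities both sides become push-forwards of one right-nested
  tensor product, so only the composed maps have to agree; associativity of \<open>*\<close> settles
  this where products are regrouped.\<close>

lemma lact_lact:
  "a \<in> l1 \<Longrightarrow> b \<in> l1 \<Longrightarrow> m \<in> l1 \<Longrightarrow> lact a (lact b m) = lact (conv a b) m"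
  by (simp add: lact_push conv_push tensor_push_left tensor_push_right tensor_assoc push_push
      case_prod_unfold mult.assoc)

lemma ract_ract:
  "a \<in> l1 \<Longrightarrow> b \<in> l1 \<Longrightarrow> m \<in> l1 \<Longrightarrow> ract (ract m a) b = ract m (conv a b)"
  by (simp add: ract_push conv_push tensor_push_left tensor_push_right tensor_assoc push_push
      case_prod_unfold mult.assoc)

lemma lact_ract:
  "a \<in> l1 \<Longrightarrow> b \<in> l1 \<Longrightarrow> m \<in> l1 \<Longrightarrow> lact a (ract m b) = ract (lact a m) b"
  by (simp add: lact_push ract_push tensor_push_left tensor_push_right tensor_assoc push_push
      case_prod_unfold)

lemma conv_assoc:
  "a \<in> l1 \<Longrightarrow> b \<in> l1 \<Longrightarrow> c \<in> l1 \<Longrightarrow> conv (conv a b) c = conv a (conv b c)"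
  by (simp add: conv_push tensor_push_left tensor_push_right tensor_assoc push_push
      case_prod_unfold mult.assoc)

lemma diag_pi_lact: "a \<in> l1 \<Longrightarrow> m \<in> l1 \<Longrightarrow> diag_pi (lact a m) = conv a (diag_pi m)"
  by (simp add: lact_push conv_push diag_pi_push tensor_push_right push_push
      case_prod_unfold mult.assoc)

lemma diag_pi_ract: "a \<in> l1 \<Longrightarrow> m \<in> l1 \<Longrightarrow> diag_pi (ract m a) = conv (diag_pi m) a"
  by (simp add: ract_push conv_push diag_pi_push tensor_push_left push_push
      case_prod_unfold mult.assoc)

lemma lact_delta:
  fixes m :: "'a \<times> 'a::semigroup_mult \<Rightarrow> complex"
  assumes "m \<in> l1"
  shows "lact (delta g) m = push (\<lambda>(w, v). (g * w, v)) m"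
proof -
  have "tensor (delta g) m = push (Pair g) m"
  proof (intro ext, clarify)
    fix x and p :: "'a \<times> 'a"
    have "{q. (g, q) = (x, p)} = (if x = g then {p} else {})" by auto
    then show "tensor (delta g) m (x, p) = push (Pair g) m (x, p)"
      by (simp add: tensor_def delta_def push_def)
  qed
  then show ?thesis
    using assms by (simp add: lact_push push_push case_prod_unfold)
qed

lemma ract_delta:
  fixes m :: "'a \<times> 'a::semigroup_mult \<Rightarrow> complex"
  assumes "m \<in> l1"
  shows "ract m (delta g) = push (\<lambda>(w, v). (w, v * g)) m"
proof -
  have "tensor m (delta g) = push (\<lambda>p. (p, g)) m"
  proof (intro ext, unfold split_paired_all)
    fix u v p :: 'a
    let ?x = "(u, v)"
    have "{q. (q, g) = (?x, p)} = (if p = g then {?x} else {})" by auto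
    then show "tensor m (delta g) (?x, p) = push (\<lambda>p. (p, g)) m (?x, p)"
      by (simp add: tensor_def delta_def push_def)
  qed
  then show ?thesis
    using assms by (simp add: ract_push push_push case_prod_unfold)
qed

lemma conv_delta_delta [simp]: "conv (delta x) (delta y) = delta (x * y)"
  by (simp add: conv_push tensor_delta)

lemma conv_add_left: "a \<in> l1 \<Longrightarrow> b \<in> l1 \<Longrightarrow> c \<in> l1 \<Longrightarrow> conv (a + b) c = conv a c + conv b c"
  by (simp add: conv_push tensor_add_left push_add)

lemma conv_add_right: "a \<in> l1 \<Longrightarrow> b \<in> l1 \<Longrightarrow> c \<in> l1 \<Longrightarrow> conv c (a + b) = conv c a + conv c b"
  by (simp add: conv_push tensor_add_right push_add)

lemma lact_add_left: "a \<in> l1 \<Longrightarrow> b \<in> l1 \<Longrightarrow> m \<in> l1 \<Longrightarrow> lact (a + b) m = lact a m + lact b m"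
  by (simp add: lact_push tensor_add_left push_add)

lemma lact_add_right: "a \<in> l1 \<Longrightarrow> m \<in> l1 \<Longrightarrow> k \<in> l1 \<Longrightarrow> lact a (m + k) = lact a m + lact a k"
  by (simp add: lact_push tensor_add_right push_add)

lemma ract_add_left: "a \<in> l1 \<Longrightarrow> m \<in> l1 \<Longrightarrow> k \<in> l1 \<Longrightarrow> ract (m + k) a = ract m a + ract k a"
  by (simp add: ract_push tensor_add_left push_add)

lemma ract_add_right: "a \<in> l1 \<Longrightarrow> b \<in> l1 \<Longrightarrow> m \<in> l1 \<Longrightarrow> ract m (a + b) = ract m a + ract m b"
  by (simp add: ract_push tensor_add_right push_add)

lemma conv_cmult_left: "conv (\<lambda>s. k * a s) c = (\<lambda>s. k * conv a c s)"
  by (simp add: conv_push tensor_cmult_left push_cmult)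

lemma conv_cmult_right: "conv c (\<lambda>s. k * a s) = (\<lambda>s. k * conv c a s)"
  by (simp add: conv_push tensor_cmult_right push_cmult)

lemma lact_cmult_left: "lact (\<lambda>s. k * a s) m = (\<lambda>s. k * lact a m s)"
  by (simp add: lact_push tensor_cmult_left push_cmult)

lemma lact_cmult_right: "lact a (\<lambda>s. k * m s) = (\<lambda>s. k * lact a m s)"
  by (simp add: lact_push tensor_cmult_right push_cmult)

lemma ract_cmult_left: "ract (\<lambda>s. k * m s) a = (\<lambda>s. k * ract m a s)"
  by (simp add: ract_push tensor_cmult_left push_cmult)

lemma ract_cmult_right: "ract m (\<lambda>s. k * a s) = (\<lambda>s. k * ract m a s)"
  by (simp add: ract_push tensor_cmult_right push_cmult)

section \<open>Bounded linear maps and characters\<close>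

lemma bounded_linear_l1_add:
  "bounded_linear_l1 T \<Longrightarrow> f \<in> l1 \<Longrightarrow> g \<in> l1 \<Longrightarrow> T (f + g) = T f + T g"
  unfolding bounded_linear_l1_def plus_fun_def by blast

lemma bounded_linear_l1_cmult:
  "bounded_linear_l1 T \<Longrightarrow> f \<in> l1 \<Longrightarrow> T (\<lambda>s. c * f s) = (\<lambda>p. c * T f p)"
  unfolding bounded_linear_l1_def by blast

lemma bounded_linear_l1_in: "bounded_linear_l1 T \<Longrightarrow> f \<in> l1 \<Longrightarrow> T f \<in> l1"
  unfolding bounded_linear_l1_def by blast

lemma bounded_linear_l1_bound:
  assumes "bounded_linear_l1 T"
  obtains C where "0 \<le> C" "\<And>f. f \<in> l1 \<Longrightarrow> l1norm (T f) \<le> C * l1norm f"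
proof -
  obtain C where C: "\<And>f. f \<in> l1 \<Longrightarrow> l1norm (T f) \<le> C * l1norm f"
    using assms unfolding bounded_linear_l1_def by blast
  show ?thesis
  proof (rule that[of "max C 0"])
    fix f :: "'a \<Rightarrow> complex" assume "f \<in> l1"
    then have "l1norm (T f) \<le> C * l1norm f" by (rule C)
    also have "\<dots> \<le> max C 0 * l1norm f" by (intro mult_right_mono) auto
    finally show "l1norm (T f) \<le> max C 0 * l1norm f" .
  qed simp
qed

lemma bounded_linear_l1_sum:
  assumes "bounded_linear_l1 T" "\<And>i. i \<in> I \<Longrightarrow> f i \<in> l1"
  shows "T (sum f I) = (\<Sum>i\<in>I. T (f i))"
proof -
  have T0: "T 0 = 0"
    using bounded_linear_l1_cmult[OF assms(1), of 0 0] l1_zero by (simp add: zero_fun_def)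
  show ?thesis using assms(2)
  proof (induction I rule: infinite_finite_induct)
    case (insert i I)
    then show ?case
      by (simp only: sum.insert[OF insert.hyps] bounded_linear_l1_add[OF assms(1)] l1_sum insertI1 insertI2)
  qed (metis T0 sum.infinite, metis T0 sum.empty)
qed

lemma bounded_linear_l1I:
  assumes "\<And>f. f \<in> l1 \<Longrightarrow> T f \<in> l1"
    and "\<And>f g. f \<in> l1 \<Longrightarrow> g \<in> l1 \<Longrightarrow> T (f + g) = T f + T g"
    and "\<And>c f. f \<in> l1 \<Longrightarrow> T (\<lambda>s. c * f s) = (\<lambda>p. c * T f p)"
    and "\<And>f. f \<in> l1 \<Longrightarrow> l1norm (T f) \<le> C * l1norm f"
  shows "bounded_linear_l1 T"
  using assms unfolding bounded_linear_l1_def plus_fun_def by blast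

lemma bounded_linear_l1_diff:
  assumes "bounded_linear_l1 S" "bounded_linear_l1 T"
  shows "bounded_linear_l1 (\<lambda>f. S f - T f)"
proof -
  obtain C where C: "\<And>f. f \<in> l1 \<Longrightarrow> l1norm (S f) \<le> C * l1norm f"
    using bounded_linear_l1_bound[OF assms(1)] by blast
  obtain D where D: "\<And>f. f \<in> l1 \<Longrightarrow> l1norm (T f) \<le> D * l1norm f"
    using bounded_linear_l1_bound[OF assms(2)] by blast
  show ?thesis
  proof (rule bounded_linear_l1I[where C = "C + D"])
    fix f :: "'a \<Rightarrow> complex" assume f: "f \<in> l1"
    show "S f - T f \<in> l1" using assms[THEN bounded_linear_l1_in, OF f] by simp
    have "l1norm (S f - T f) \<le> l1norm (S f) + l1norm (T f)"
      by (rule l1norm_diff[OF bounded_linear_l1_in[OF assms(1) f] bounded_linear_l1_in[OF assms(2) f]])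
    with C[OF f] D[OF f] show "l1norm (S f - T f) \<le> (C + D) * l1norm f"
      by (simp add: algebra_simps)
  qed (simp_all add: assms[THEN bounded_linear_l1_add] assms[THEN bounded_linear_l1_cmult]
      fun_eq_iff algebra_simps)
qed

lemma finite_support_approximation:
  fixes a :: "'b \<Rightarrow> complex"
  assumes "a \<in> l1" "\<epsilon> > 0"
  obtains K where "finite K" "l1norm (a - (\<Sum>s\<in>K. (\<lambda>t. a s * delta s t))) \<le> \<epsilon>"
proof -
  obtain K where K: "finite K"
    "dist (\<Sum>s\<in>K. norm (a s)) (infsum (\<lambda>s. norm (a s)) UNIV) \<le> \<epsilon>"
    using infsum_finite_approximation[of "\<lambda>s. norm (a s)" UNIV \<epsilon>] assms l1D by blast
  let ?b = "a - (\<Sum>s\<in>K. (\<lambda>t. a s * delta s t))"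
  have b: "?b t = (if t \<in> K then 0 else a t)" for t
  proof -
    have "(\<Sum>s\<in>K. (\<lambda>t. a s * delta s t)) t = (\<Sum>s\<in>K. a s * delta s t)"
      using K(1) by (induction K) (auto simp: zero_fun_def plus_fun_def)
    also have "\<dots> = (\<Sum>s\<in>K. if s = t then a s else 0)"
      by (intro sum.cong) (auto simp: delta_def)
    also have "\<dots> = (if t \<in> K then a t else 0)" using K(1) by simp
    finally show ?thesis by simp
  qed
  have "l1norm ?b = infsum (\<lambda>s. norm (a s)) (UNIV - K)"
    unfolding l1norm_def b by (intro infsum_cong_neutral) auto
  moreover have "infsum (\<lambda>s. norm (a s)) UNIV =
      infsum (\<lambda>s. norm (a s)) K + infsum (\<lambda>s. norm (a s)) (UNIV - K)"
    using infsum_Un_disjoint[of "\<lambda>s. norm (a s)" K "UNIV - K"] K(1) l1D[OF assms(1)] by auto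
  ultimately have "l1norm ?b \<le> \<epsilon>"
    using K by (simp add: dist_real_def)
  with K(1) show ?thesis by (rule that)
qed

text \<open>The triangle inequality gives the bound on finite combinations of point masses. These
  are dense, and boundedness of \<open>T\<close> controls the remainder.\<close>

lemma l1norm_bounded_linear_le:
  assumes T: "bounded_linear_l1 T" and a: "a \<in> l1"
    and c: "\<And>s. l1norm (T (delta s)) \<le> c s" "(\<lambda>s. norm (a s) * c s) summable_on UNIV"
  shows "l1norm (T a) \<le> infsum (\<lambda>s. norm (a s) * c s) UNIV"
proof (rule field_le_epsilon)
  fix e :: real assume e: "e > 0"
  obtain C where C: "0 \<le> C" "\<And>f. f \<in> l1 \<Longrightarrow> l1norm (T f) \<le> C * l1norm f"
    using bounded_linear_l1_bound[OF T] by blast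
  \<comment> \<open>Dividing by \<open>C + 1\<close> instead of \<open>C\<close> covers the case
    \<open>C = 0\<close>.\<close>
  obtain K where K: "finite K" "l1norm (a - (\<Sum>s\<in>K. (\<lambda>t. a s * delta s t))) \<le> e / (C + 1)"
    using finite_support_approximation[OF a, of "e / (C + 1)"] C(1) e by auto
  let ?k = "\<Sum>s\<in>K. (\<lambda>t. a s * delta s t)"
  have k: "?k \<in> l1" by (intro l1_sum) simp
  have c0: "0 \<le> c s" for s using c(1)[of s] l1norm_nonneg[of "T (delta s)"] by linarith
  have "T ?k = (\<Sum>s\<in>K. T (\<lambda>t. a s * delta s t))"
    by (rule bounded_linear_l1_sum[OF T]) simp
  then have "l1norm (T ?k) \<le> (\<Sum>s\<in>K. l1norm (T (\<lambda>t. a s * delta s t)))"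
    by (simp only:) (intro l1norm_sum bounded_linear_l1_in[OF T] l1_cmult delta_l1)
  also have "\<dots> = (\<Sum>s\<in>K. norm (a s) * l1norm (T (delta s)))"
    by (simp add: bounded_linear_l1_cmult[OF T] l1norm_cmult)
  also have "\<dots> \<le> (\<Sum>s\<in>K. norm (a s) * c s)"
    by (intro sum_mono mult_left_mono c) simp
  also have "\<dots> \<le> infsum (\<lambda>s. norm (a s) * c s) UNIV"
    by (intro finite_sum_le_infsum c K) (auto simp: c0)
  finally have 1: "l1norm (T ?k) \<le> infsum (\<lambda>s. norm (a s) * c s) UNIV" .
  have "T a = T ?k + T (a - ?k)"
    using bounded_linear_l1_add[OF T k l1_diff[OF a k]] by (simp only: add_diff_cancel_left'
      add.commute[of ?k] diff_add_cancel)
  then have "l1norm (T a) \<le> l1norm (T ?k) + l1norm (T (a - ?k))"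
    by (simp only:) (intro l1norm_add bounded_linear_l1_in[OF T] k l1_diff a)
  moreover have "l1norm (T (a - ?k)) \<le> C * l1norm (a - ?k)"
    by (intro C k l1_diff a)
  moreover have "C * l1norm (a - ?k) \<le> C * (e / (C + 1))"
    using K(2) C(1) by (rule mult_left_mono)
  moreover have "C * (e / (C + 1)) \<le> e"
    using C(1) e by (simp add: field_simps)
  ultimately show "l1norm (T a) \<le> infsum (\<lambda>s. norm (a s) * c s) UNIV + e"
    using 1 by linarith
qed

text \<open>This turns control on finite sets into convergence: a merely uniform bound
  \<open>D\<close> off \<open>K\<close> is harmless, because the mass of \<open>a\<close> off
  \<open>K\<close> is small for large \<open>K\<close>.\<close>

lemma l1norm_bounded_linear_split:
  assumes T: "bounded_linear_l1 T" and a: "a \<in> l1"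
    and \<eta>: "\<And>s. s \<in> K \<Longrightarrow> l1norm (T (delta s)) \<le> \<eta>" "0 \<le> \<eta>"
    and D: "\<And>s. l1norm (T (delta s)) \<le> D"
  shows "l1norm (T a) \<le> \<eta> * l1norm a + D * infsum (\<lambda>s. norm (a s)) (- K)"
proof -
  let ?c = "\<lambda>s. \<eta> + (if s \<in> K then 0 else D)"
  have sm: "(\<lambda>s. \<eta> * norm (a s)) summable_on UNIV"
    "(\<lambda>s. if s \<in> K then 0 else D * norm (a s)) summable_on UNIV"
  proof -
    show "(\<lambda>s. \<eta> * norm (a s)) summable_on UNIV"
      by (intro summable_on_cmult_right l1D a)
    have "(\<lambda>s. D * norm (a s)) summable_on (- K)"
      by (intro summable_on_cmult_right l1D a)
    then show "(\<lambda>s. if s \<in> K then 0 else D * norm (a s)) summable_on UNIV"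
      by (rule summable_on_cong_neutral[THEN iffD1, rotated -1]) auto
  qed
  have eq: "norm (a s) * ?c s = \<eta> * norm (a s) + (if s \<in> K then 0 else D * norm (a s))" for s
    by (simp add: algebra_simps)
  have "l1norm (T a) \<le> infsum (\<lambda>s. norm (a s) * ?c s) UNIV"
  proof (rule l1norm_bounded_linear_le[OF T a])
    show "l1norm (T (delta s)) \<le> ?c s" for s
      using \<eta> D[of s] by auto
    show "(\<lambda>s. norm (a s) * ?c s) summable_on UNIV"
      unfolding eq by (intro summable_on_add sm)
  qed
  also have "\<dots> = infsum (\<lambda>s. \<eta> * norm (a s)) UNIV +
      infsum (\<lambda>s. if s \<in> K then 0 else D * norm (a s)) UNIV"
    unfolding eq by (intro infsum_add sm)
  also have "infsum (\<lambda>s. if s \<in> K then 0 else D * norm (a s)) UNIV =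
      infsum (\<lambda>s. D * norm (a s)) (- K)"
    by (intro infsum_cong_neutral) auto
  finally show ?thesis
    by (simp add: l1norm_def infsum_cmult_right')
qed

section \<open>Functionals given by bounded weights, and characters as semicharacters\<close>

definition weighted_sum :: "('b \<Rightarrow> complex) \<Rightarrow> ('b \<Rightarrow> complex) \<Rightarrow> complex" where
  "weighted_sum \<psi> f = infsum (\<lambda>s. \<psi> s * f s) UNIV"

lemma weighted_sum_push:
  assumes "h \<in> l1" "\<forall>t. norm (\<psi> t) \<le> C"
  shows "weighted_sum \<psi> (push f h) = weighted_sum (\<lambda>p. \<psi> (f p)) h"
proof -
  have "(\<lambda>p. \<psi> (f p) * h p) \<in> l1" using l1_mult_bounded(1) assms by metis
  then show ?thesis
    unfolding weighted_sum_def push_mult[of f \<psi> h, symmetric] by (simp add: infsum_push)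
qed

lemma weighted_sum_tensor:
  assumes "f \<in> l1" "g \<in> l1" "\<forall>t. norm (\<psi> t) \<le> C" "\<forall>t. norm (\<xi> t) \<le> D"
  shows "weighted_sum (\<lambda>(x, y). \<psi> x * \<xi> y) (tensor f g) = weighted_sum \<psi> f * weighted_sum \<xi> g"
proof -
  have "(\<lambda>p. \<psi> p * f p) \<in> l1" "(\<lambda>p. \<xi> p * g p) \<in> l1" using l1_mult_bounded(1) assms by metis+
  from infsum_tensor[OF this] show ?thesis
    by (simp add: weighted_sum_def tensor_def case_prod_unfold algebra_simps)
qed

lemma norm_weighted_sum_le:
  assumes "f \<in> l1" "\<forall>t. norm (\<psi> t) \<le> C"
  shows "norm (weighted_sum \<psi> f) \<le> C * l1norm f"
proof -
  have "norm (weighted_sum \<psi> f) \<le> l1norm (\<lambda>s. \<psi> s * f s)"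
    unfolding weighted_sum_def by (intro norm_infsum_le_l1norm l1_mult_bounded(1)[where C = C] assms)
  also have "\<dots> \<le> C * l1norm f"
    by (intro l1_mult_bounded(2) assms)
  finally show ?thesis .
qed

lemma weighted_sum_add:
  assumes "f \<in> l1" "g \<in> l1" "\<forall>t. norm (\<psi> t) \<le> C"
  shows "weighted_sum \<psi> (f + g) = weighted_sum \<psi> f + weighted_sum \<psi> g"
proof -
  have "(\<lambda>p. \<psi> p * f p) \<in> l1" "(\<lambda>p. \<psi> p * g p) \<in> l1" using l1_mult_bounded(1) assms by metis+
  then have "infsum (\<lambda>p. \<psi> p * f p + \<psi> p * g p) UNIV =
      infsum (\<lambda>p. \<psi> p * f p) UNIV + infsum (\<lambda>p. \<psi> p * g p) UNIV"
    by (intro infsum_add l1_summable)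
  then show ?thesis by (simp add: weighted_sum_def algebra_simps)
qed

lemma weighted_sum_cmult: "weighted_sum \<psi> (\<lambda>s. c * f s) = c * weighted_sum \<psi> f"
  unfolding weighted_sum_def by (simp add: infsum_cmult_right'[symmetric] algebra_simps)

lemma weighted_sum_delta [simp]: "weighted_sum \<psi> (delta s) = \<psi> s"
  unfolding weighted_sum_def by (rule infsum_delta)

lemma weighted_sum_conv:
  assumes "f \<in> l1" "g \<in> l1" "\<forall>t. norm (\<psi> t) \<le> C" "\<forall>s t. \<psi> (s * t) = \<psi> s * \<psi> t"
  shows "weighted_sum \<psi> (conv f g) = weighted_sum \<psi> f * weighted_sum \<psi> g"
  using assms weighted_sum_tensor[of f g \<psi> C \<psi> C]
  by (simp add: conv_push weighted_sum_push[where C = C] case_prod_unfold)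

lemma character_weighted_sum:
  assumes "\<forall>t. norm (\<psi> t) \<le> C" "\<forall>s t. \<psi> (s * t) = \<psi> s * \<psi> t" "\<psi> s \<noteq> 0"
  shows "character (weighted_sum \<psi>)"
  unfolding character_def
proof (intro conjI ballI allI)
  show "\<exists>C. \<forall>f\<in>l1. norm (weighted_sum \<psi> f) \<le> C * l1norm f"
    using norm_weighted_sum_le[of _ \<psi> C] assms by blast
  show "\<exists>f\<in>l1. weighted_sum \<psi> f \<noteq> 0"
    using assms(3) by (intro bexI[of _ "delta s"]) simp_all
qed (use assms in \<open>simp_all add: weighted_sum_conv[where C = C] weighted_sum_cmult
    weighted_sum_add[where C = C, unfolded plus_fun_def]\<close>)

text \<open>The weight is the restriction of \<open>\<phi>\<close> to point masses. It is
  multiplicative because \<open>\<phi>\<close> is, and boundedness propagates agreement on point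
  masses to all of \<open>l1\<close>.\<close>

lemma character_eq_weighted_sum:
  fixes \<phi> :: "('a::semigroup_mult \<Rightarrow> complex) \<Rightarrow> complex"
  assumes "character \<phi>"
  obtains \<kappa> C s where "\<forall>s. norm (\<kappa> s) \<le> C" "\<forall>s t. \<kappa> (s * t) = \<kappa> s * \<kappa> t" "\<kappa> s \<noteq> 0"
    "\<And>f. f \<in> l1 \<Longrightarrow> \<phi> f = weighted_sum \<kappa> f"
proof -
  from assms have add: "\<And>f g. f \<in> l1 \<Longrightarrow> g \<in> l1 \<Longrightarrow> \<phi> (f + g) = \<phi> f + \<phi> g"
    and cmult: "\<And>c f. f \<in> l1 \<Longrightarrow> \<phi> (\<lambda>s. c * f s) = c * \<phi> f"
    and mult: "\<And>f g. f \<in> l1 \<Longrightarrow> g \<in> l1 \<Longrightarrow> \<phi> (conv f g) = \<phi> f * \<phi> g"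
    and "\<exists>C. \<forall>f\<in>l1. norm (\<phi> f) \<le> C * l1norm f" "\<exists>f\<in>l1. \<phi> f \<noteq> 0"
    unfolding character_def plus_fun_def by blast+
  then obtain C f0 where C: "\<And>f. f \<in> l1 \<Longrightarrow> norm (\<phi> f) \<le> C * l1norm f"
    and f0: "f0 \<in> l1" "\<phi> f0 \<noteq> 0" by blast
  define \<kappa> where "\<kappa> s = \<phi> (delta s)" for s
  have bd: "\<forall>s. norm (\<kappa> s) \<le> C"
  proof
    show "norm (\<kappa> s) \<le> C" for s
      unfolding \<kappa>_def using C[of "delta s"] by simp
  qed
  \<comment> \<open>Functions on \<open>unit\<close> stand in for scalars, so that the estimates for
    operators between \<open>l1\<close> spaces apply to functionals.\<close>
  have unit: "(f :: unit \<Rightarrow> complex) \<in> l1" "l1norm f = norm (f ())" for f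
    by (simp_all add: l1_def l1norm_def UNIV_unit)
  define T where "T f = (\<lambda>_::unit. \<phi> f) - (\<lambda>_::unit. weighted_sum \<kappa> f)" for f
  have "bounded_linear_l1 (\<lambda>f. (\<lambda>_::unit. \<phi> f))"
    by (rule bounded_linear_l1I[where C = C]) (simp_all only: unit add cmult C, auto)
  moreover have "bounded_linear_l1 (\<lambda>f. (\<lambda>_::unit. weighted_sum \<kappa> f))"
  proof (rule bounded_linear_l1I[where C = C])
    fix f g :: "'a \<Rightarrow> complex"
    assume "f \<in> l1" "g \<in> l1"
    then show "(\<lambda>_::unit. weighted_sum \<kappa> (f + g)) =
        (\<lambda>_. weighted_sum \<kappa> f) + (\<lambda>_. weighted_sum \<kappa> g)"
      using weighted_sum_add[of f g \<kappa> C] bd by auto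
  qed (auto simp: unit weighted_sum_cmult intro: norm_weighted_sum_le[OF _ bd])
  ultimately have T: "bounded_linear_l1 T"
    unfolding T_def by (rule bounded_linear_l1_diff)
  have eq: "\<phi> f = weighted_sum \<kappa> f" if f: "f \<in> l1" for f
  proof -
    \<comment> \<open>The difference \<open>T\<close> kills every point mass, so the bounding weight
      can be taken to be \<open>0\<close>.\<close>
    have "l1norm (T f) \<le> infsum (\<lambda>s. norm (f s) * 0) UNIV"
      by (rule l1norm_bounded_linear_le[OF T f]) (simp_all add: T_def unit \<kappa>_def)
    then show ?thesis by (simp add: unit T_def)
  qed
  have "\<exists>s. \<kappa> s \<noteq> 0"
  proof (rule ccontr)
    assume "\<not> ?thesis"
    then have "\<kappa> = (\<lambda>_. 0)" by auto
    with eq[OF f0(1)] f0(2) show False by (simp add: weighted_sum_def)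
  qed
  then obtain s where "\<kappa> s \<noteq> 0" ..
  moreover have "\<kappa> (s * t) = \<kappa> s * \<kappa> t" for s t
    unfolding \<kappa>_def using mult[of "delta s" "delta t"] by simp
  ultimately show ?thesis using that[of \<kappa> C s] bd eq by blast
qed

section \<open>From pseudo-amenability to approximate biprojectivity\<close>

text \<open>This is the slice map \<open>id \<otimes> \<phi>\<close> for the functional
  \<open>\<phi>\<close> with weight \<open>\<kappa>\<close>.\<close>

definition slice :: "('c \<Rightarrow> complex) \<Rightarrow> ('b \<times> 'c \<Rightarrow> complex) \<Rightarrow> 'b \<Rightarrow> complex" where
  "slice \<kappa> m = push fst (\<lambda>p. \<kappa> (snd p) * m p)"

lemma
  assumes "m \<in> l1" "\<forall>t. norm (\<kappa> t) \<le> C"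
  shows slice_l1: "slice \<kappa> m \<in> l1" and l1norm_slice: "l1norm (slice \<kappa> m) \<le> C * l1norm m"
proof -
  have *: "(\<lambda>p. \<kappa> (snd p) * m p) \<in> l1" "l1norm (\<lambda>p. \<kappa> (snd p) * m p) \<le> C * l1norm m"
    using assms l1_mult_bounded[of m "\<lambda>p. \<kappa> (snd p)" C] by auto
  then show "slice \<kappa> m \<in> l1" "l1norm (slice \<kappa> m) \<le> C * l1norm m"
    using l1norm_push[OF *(1), of fst] by (auto simp: slice_def)
qed

lemma slice_push:
  assumes "m \<in> l1" "\<forall>t. norm (\<kappa> t) \<le> C"
  shows "slice \<kappa> (push f m) = push (\<lambda>p. fst (f p)) (\<lambda>p. \<kappa> (snd (f p)) * m p)"
proof -
  have "(\<lambda>p. \<kappa> (snd (f p)) * m p) \<in> l1"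
    using assms by (auto intro!: l1_mult_bounded(1)[where C = C])
  then show ?thesis
    unfolding slice_def push_mult[of f "\<lambda>q. \<kappa> (snd q)" m, symmetric] by (simp add: push_push)
qed

lemma slice_lact:
  fixes a :: "'a::semigroup_mult \<Rightarrow> complex"
  assumes "a \<in> l1" "m \<in> l1" "\<forall>t. norm (\<kappa> t) \<le> C"
  shows "slice \<kappa> (lact a m) = conv a (slice \<kappa> m)"
proof -
  have 1: "(\<lambda>p. \<kappa> (snd p) * m p) \<in> l1"
    using assms by (auto intro!: l1_mult_bounded(1)[where C = C])
  have 2: "(\<lambda>p. \<kappa> (snd (snd p)) * tensor a m p) = tensor a (\<lambda>p. \<kappa> (snd p) * m p)"
    by (auto simp: tensor_def)
  show ?thesis
    using assms 1 unfolding lact_push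
    by (subst slice_push[where C = C])
      (simp_all add: slice_def conv_push tensor_push_right push_push case_prod_unfold 2)
qed

text \<open>The second leg is evaluated by a multiplicative functional, under which right
  multiplication by \<open>a\<close> becomes a scalar factor.\<close>

lemma slice_ract:
  fixes a :: "'a::semigroup_mult \<Rightarrow> complex"
  assumes "a \<in> l1" "m \<in> l1" "\<forall>t. norm (\<kappa> t) \<le> C" "\<forall>s t. \<kappa> (s * t) = \<kappa> s * \<kappa> t"
  shows "slice \<kappa> (ract m a) = (\<lambda>s. weighted_sum \<kappa> a * slice \<kappa> m s)"
proof -
  let ?m = "\<lambda>p. \<kappa> (snd p) * m p" and ?a = "\<lambda>y. \<kappa> y * a y"
  have 1: "?m \<in> l1" "?a \<in> l1"
    using assms by (auto intro: l1_mult_bounded(1)[where C = C])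
  have 2: "(\<lambda>p. \<kappa> (snd (fst p)) * \<kappa> (snd p) * tensor m a p) = tensor ?m ?a"
    by (auto simp: tensor_def)
  have 3: "push fst (tensor ?m ?a) = (\<lambda>p. infsum ?a UNIV * ?m p)"
  proof
    fix p
    have "push fst (tensor ?m ?a) p = infsum (tensor ?m ?a) (Pair p ` UNIV)"
      unfolding push_def by (rule arg_cong[of _ _ "infsum _"]) auto
    also have "\<dots> = ?m p * infsum ?a UNIV"
      by (subst infsum_reindex) (simp_all add: inj_on_def o_def tensor_def infsum_cmult_right')
    finally show "push fst (tensor ?m ?a) p = infsum ?a UNIV * ?m p" by simp
  qed
  have "slice \<kappa> (ract m a) = push (\<lambda>p. fst (fst p)) (tensor ?m ?a)"
    using assms 1 unfolding ract_push
    by (subst slice_push[where C = C]) (simp_all add: case_prod_unfold 2)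
  also have "\<dots> = push fst (push fst (tensor ?m ?a))"
    using 1 by (simp add: push_push)
  also have "\<dots> = (\<lambda>s. infsum ?a UNIV * slice \<kappa> m s)"
    unfolding 3 push_cmult slice_def ..
  finally show ?thesis by (simp add: weighted_sum_def)
qed

lemma lact_tensor: "lact a (tensor f b) = tensor (conv a f) b"
  by (auto simp: lact_def tensor_def conv_def infsum_cmult_left'[symmetric] case_prod_unfold
      mult.assoc)

lemma slice_diff:
  assumes "m \<in> l1" "k \<in> l1" "\<forall>t. norm (\<kappa> t) \<le> C"
  shows "slice \<kappa> (m - k) = slice \<kappa> m - slice \<kappa> k"
proof -
  have "(\<lambda>p. \<kappa> (snd p) * (m - k) p) = (\<lambda>p. \<kappa> (snd p) * m p) - (\<lambda>p. \<kappa> (snd p) * k p)"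
    by (auto simp: algebra_simps)
  then show ?thesis
    unfolding slice_def using assms
    by (simp only:) (intro push_diff l1_mult_bounded(1)[where C = C] assms, simp_all)
qed

lemma weighted_sum_slice:
  assumes "m \<in> l1" "\<forall>t. norm (\<kappa> t) \<le> C" "\<forall>s t. \<kappa> (s * t) = \<kappa> s * \<kappa> t"
  shows "weighted_sum \<kappa> (slice \<kappa> m) = weighted_sum \<kappa> (diag_pi m)"
proof -
  have 1: "(\<lambda>p. \<kappa> (snd p) * m p) \<in> l1"
    using assms by (auto intro!: l1_mult_bounded(1)[where C = C])
  have "weighted_sum \<kappa> (slice \<kappa> m) = weighted_sum (\<lambda>p. \<kappa> (fst p)) (\<lambda>p. \<kappa> (snd p) * m p)"
    unfolding slice_def by (rule weighted_sum_push[OF 1 assms(2)])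
  moreover have "weighted_sum \<kappa> (diag_pi m) = weighted_sum (\<lambda>p. \<kappa> (fst p) * \<kappa> (snd p)) m"
    unfolding diag_pi_push using weighted_sum_push[OF assms(1,2)] assms(3)
    by (simp add: case_prod_unfold)
  ultimately show ?thesis by (simp add: weighted_sum_def mult.assoc)
qed

theorem pseudo_amenable_imp_approx_left_phi_biprojective:
  fixes star :: "'a::semigroup_mult \<Rightarrow> 'a" and \<phi> :: "('a \<Rightarrow> complex) \<Rightarrow> complex"
  assumes "pseudo_amenable star" "character \<phi>"
  shows "approx_left_phi_biprojective \<phi>"
proof -
  obtain F :: "('a \<times> 'a \<Rightarrow> complex) filter" where F: "F \<noteq> bot" "\<forall>\<^sub>F m in F. m \<in> l1"
    "\<And>a. a \<in> l1 \<Longrightarrow> ((\<lambda>m. l1norm (lact a m - ract m a)) \<longlongrightarrow> 0) F"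
    "\<And>a. a \<in> l1 \<Longrightarrow> ((\<lambda>m. l1norm (conv (diag_pi m) a - a)) \<longlongrightarrow> 0) F"
    using assms(1) unfolding pseudo_amenable_def fun_diff_def by blast
  obtain \<kappa> C s0 where \<kappa>: "\<forall>s. norm (\<kappa> s) \<le> C" "\<forall>s t. \<kappa> (s * t) = \<kappa> s * \<kappa> t" "\<kappa> s0 \<noteq> 0"
    and \<phi>: "\<And>f. f \<in> l1 \<Longrightarrow> \<phi> f = weighted_sum \<kappa> f"
    using character_eq_weighted_sum[OF assms(2)] by metis
  define b where "b = (\<lambda>s. inverse (\<kappa> s0) * delta s0 s)"
  have b: "b \<in> l1" "weighted_sum \<kappa> b = 1"
    using \<kappa>(3) by (simp_all add: b_def weighted_sum_cmult)
  define n where "n m = tensor (slice \<kappa> m) b" for m :: "'a \<times> 'a \<Rightarrow> complex"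
  define \<rho> where "\<rho> m f = (\<lambda>p. \<phi> f * n m p)" for m f
  have n: "n m \<in> l1" if "m \<in> l1" for m
    unfolding n_def using that b slice_l1[OF that \<kappa>(1)] by simp
  have \<phi>_conv: "\<phi> (conv a x) = \<phi> a * \<phi> x" if "a \<in> l1" "x \<in> l1" for a x
    using that assms(2) unfolding character_def by blast
  have bounded: "bounded_linear_l1 (\<rho> m)" if "m \<in> l1" for m
  proof (rule bounded_linear_l1I[where C = "C * l1norm (n m)"])
    fix f :: "'a \<Rightarrow> complex" assume f: "f \<in> l1"
    show "\<rho> m f \<in> l1" using n[OF that] by (simp add: \<rho>_def)
    show "\<rho> m (\<lambda>s. c * f s) = (\<lambda>p. c * \<rho> m f p)" for c
      using f by (simp add: \<rho>_def \<phi> weighted_sum_cmult mult.assoc)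
    have "norm (\<phi> f) * l1norm (n m) \<le> (C * l1norm f) * l1norm (n m)"
      using f norm_weighted_sum_le[OF f \<kappa>(1)] by (intro mult_right_mono) (simp_all add: \<phi>)
    then show "l1norm (\<rho> m f) \<le> C * l1norm (n m) * l1norm f"
      by (simp add: \<rho>_def l1norm_cmult mult_ac)
    fix g :: "'a \<Rightarrow> complex" assume g: "g \<in> l1"
    show "\<rho> m (f + g) = \<rho> m f + \<rho> m g"
      using f g l1_add[OF f g] weighted_sum_add[OF f g \<kappa>(1)]
      by (simp add: \<rho>_def \<phi> fun_eq_iff algebra_simps)
  qed
  have left: "l1norm (lact a (\<rho> m x) - \<rho> m (conv a x)) \<le>
      norm (\<phi> x) * (C * l1norm b) * l1norm (lact a m - ract m a)"
    if "m \<in> l1" "a \<in> l1" "x \<in> l1" for m a x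
  proof -
    let ?d = "lact a m - ract m a"
    have d: "?d \<in> l1" using that by simp
    \<comment> \<open>Slicing the commutator keeps the left action and turns the right action into
      the scalar \<open>\<phi> a\<close>; this is exactly the defect in the first condition of
      biprojectivity.\<close>
    have "slice \<kappa> ?d = conv a (slice \<kappa> m) - (\<lambda>s. \<phi> a * slice \<kappa> m s)"
      using that by (simp add: slice_diff[OF _ _ \<kappa>(1)] slice_lact[OF _ _ \<kappa>(1)]
          slice_ract[OF _ _ \<kappa>(1,2)] \<phi>)
    note eq = this
    have "lact a (\<rho> m x) - \<rho> m (conv a x) = (\<lambda>p. \<phi> x * tensor (slice \<kappa> ?d) b p)"
      unfolding \<rho>_def lact_cmult_right n_def lact_tensor \<phi>_conv[OF that(2,3)] eq
      by (auto simp: tensor_def fun_eq_iff algebra_simps)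
    then have "l1norm (lact a (\<rho> m x) - \<rho> m (conv a x)) =
        norm (\<phi> x) * (l1norm (slice \<kappa> ?d) * l1norm b)"
      by (simp only: l1norm_cmult l1norm_tensor[OF slice_l1[OF d \<kappa>(1)] b(1)])
    also have "\<dots> \<le> norm (\<phi> x) * (C * l1norm ?d * l1norm b)"
      using l1norm_slice[OF d \<kappa>(1)] by (intro mult_left_mono mult_right_mono) simp_all
    finally show ?thesis by (simp only: mult_ac)
  qed
  \<comment> \<open>The second condition holds without error, since \<open>\<rho> m\<close> factors
    through the character.\<close>
  have right: "\<rho> m (conv x a) - (\<lambda>p. \<phi> a * \<rho> m x p) = 0" if "a \<in> l1" "x \<in> l1" for m a x
    using that by (auto simp: \<rho>_def \<phi>_conv)
  have diag: "\<phi> (diag_pi (\<rho> m x)) = \<phi> x * weighted_sum \<kappa> (diag_pi m)"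
    if "m \<in> l1" "x \<in> l1" for m x
  proof -
    have "diag_pi (\<rho> m x) = (\<lambda>s. \<phi> x * diag_pi (n m) s)"
      unfolding \<rho>_def diag_pi_push push_cmult ..
    moreover have "\<phi> (diag_pi (n m)) = weighted_sum \<kappa> (slice \<kappa> m) * weighted_sum \<kappa> b"
      unfolding n_def using weighted_sum_conv[OF slice_l1[OF that(1) \<kappa>(1)] b(1) \<kappa>(1,2)]
        slice_l1[OF that(1) \<kappa>(1)] b(1)
      by (simp add: diag_pi_push conv_push \<phi>)
    ultimately show ?thesis
      using n[OF that(1)] b(2) by (simp add: \<phi> weighted_sum_cmult weighted_sum_slice[OF that(1) \<kappa>(1,2)])
  qed
  \<comment> \<open>Apply the character to the approximate identity condition at
    \<open>delta s0\<close> and divide by \<open>\<kappa> s0 \<noteq> 0\<close>.\<close>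
  have diag_lim: "((\<lambda>m. weighted_sum \<kappa> (diag_pi m)) \<longlongrightarrow> 1) F"
  proof -
    have "((\<lambda>m. C / norm (\<kappa> s0) * l1norm (conv (diag_pi m) (delta s0) - delta s0)) \<longlongrightarrow> 0) F"
      by (intro tendsto_mult_right_zero F(4)) simp
    moreover have "\<forall>\<^sub>F m in F. norm (weighted_sum \<kappa> (diag_pi m) - 1) \<le>
        C / norm (\<kappa> s0) * l1norm (conv (diag_pi m) (delta s0) - delta s0)"
      using F(2)
    proof eventually_elim
      case (elim m)
      let ?d = "conv (diag_pi m) (delta s0) - delta s0"
      have "weighted_sum \<kappa> ?d + weighted_sum \<kappa> (delta s0) = weighted_sum \<kappa> (diag_pi m) * \<kappa> s0"
        using elim weighted_sum_add[of ?d "delta s0" \<kappa> C] \<kappa> weighted_sum_conv[of "diag_pi m" "delta s0" \<kappa> C]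
        by simp
      then have "(weighted_sum \<kappa> (diag_pi m) - 1) * \<kappa> s0 = weighted_sum \<kappa> ?d"
        by (simp add: algebra_simps)
      moreover have "norm (weighted_sum \<kappa> ?d) \<le> C * l1norm ?d"
        using elim by (intro norm_weighted_sum_le \<kappa>) simp
      ultimately have "norm (weighted_sum \<kappa> (diag_pi m) - 1) * norm (\<kappa> s0) \<le> C * l1norm ?d"
        by (metis norm_mult)
      then show ?case using \<kappa>(3) by (simp add: field_simps)
    qed
    ultimately have "((\<lambda>m. weighted_sum \<kappa> (diag_pi m) - 1) \<longlongrightarrow> 0) F"
      by (rule Lim_null_comparison[rotated])
    then show ?thesis by (simp add: LIM_zero_iff)
  qed
  show ?thesis
    unfolding approx_left_phi_biprojective_def
  proof (intro exI[of _ "filtermap \<rho> F"] conjI ballI)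
    show "filtermap \<rho> F \<noteq> bot" using F(1) by (simp add: filtermap_bot_iff)
    show "\<forall>\<^sub>F \<rho> in filtermap \<rho> F. bounded_linear_l1 \<rho>"
      unfolding eventually_filtermap using F(2) by eventually_elim (rule bounded)
    fix a x :: "'a \<Rightarrow> complex" assume ax: "a \<in> l1" "x \<in> l1"
    have "((\<lambda>m. norm (\<phi> x) * (C * l1norm b) * l1norm (lact a m - ract m a)) \<longlongrightarrow> 0) F"
      by (intro tendsto_mult_right_zero F(3) ax)
    moreover have "\<forall>\<^sub>F m in F. norm (l1norm (lact a (\<rho> m x) - \<rho> m (conv a x))) \<le>
        norm (\<phi> x) * (C * l1norm b) * l1norm (lact a m - ract m a)"
      using F(2) by eventually_elim (use left ax in simp)
    ultimately have "((\<lambda>m. l1norm (lact a (\<rho> m x) - \<rho> m (conv a x))) \<longlongrightarrow> 0) F"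
      by (rule Lim_null_comparison[rotated])
    then show "((\<lambda>\<rho>. l1norm (\<lambda>p. lact a (\<rho> x) p - \<rho> (conv a x) p)) \<longlongrightarrow> 0) (filtermap \<rho> F)"
      by (simp add: filterlim_filtermap fun_diff_def)
    show "((\<lambda>\<rho>. l1norm (\<lambda>p. \<rho> (conv x a) p - \<phi> a * \<rho> x p)) \<longlongrightarrow> 0) (filtermap \<rho> F)"
      using right[OF ax] by (simp add: filterlim_filtermap fun_diff_def)
    have "((\<lambda>m. \<phi> x * weighted_sum \<kappa> (diag_pi m) - \<phi> x) \<longlongrightarrow> \<phi> x * 1 - \<phi> x) F"
      by (intro tendsto_intros diag_lim)
    moreover have "\<forall>\<^sub>F m in F. \<phi> x * weighted_sum \<kappa> (diag_pi m) - \<phi> x = \<phi> (diag_pi (\<rho> m x)) - \<phi> x"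
      using F(2) by eventually_elim (simp add: diag ax)
    ultimately have "((\<lambda>m. \<phi> (diag_pi (\<rho> m x)) - \<phi> x) \<longlongrightarrow> 0) F"
      using Lim_transform_eventually by fastforce
    then show "((\<lambda>\<rho>. \<phi> (diag_pi (\<rho> x)) - \<phi> x) \<longlongrightarrow> 0) (filtermap \<rho> F)"
      by (simp add: filterlim_filtermap)
  qed
qed

section \<open>Clifford semigroups and Reiter's condition\<close>

locale clifford =
  fixes star :: "'a::semigroup_mult \<Rightarrow> 'a"
  assumes clifford: "clifford_semigroup star"
begin

lemma star1: "s * star s * s = s" and star2: "star s * s * star s = star s"
  and star_unique: "s * t * s = s \<Longrightarrow> t * s * t = t \<Longrightarrow> t = star s"
  and star_commute: "star s * s = s * star s"
  using clifford unfolding clifford_semigroup_def inverse_semigroup_def by metis+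

lemma star_star [simp]: "star (star s) = s"
  by (metis star1 star2 star_unique)

lemma star_idem: "e * e = e \<Longrightarrow> star e = e"
  by (metis star_unique)

text \<open>If \<open>x\<close> is the inverse of \<open>e * f\<close>, then
  \<open>f * x * e\<close> is another one, so uniqueness gives \<open>x = f * x * e\<close>. This
  form makes \<open>x\<close> idempotent, hence its own inverse, hence equal to
  \<open>e * f\<close>.\<close>

lemma idem_mult_idem:
  fixes e f :: 'a
  assumes e: "e * e = e" and f: "f * f = f"
  shows "(e * f) * (e * f) = e * f"
proof -
  define x where "x = star (e * f)"
  have x1: "e * f * x * (e * f) = e * f" and x2: "x * (e * f) * x = x"
    unfolding x_def by (rule star1, rule star2)
  have "(e * f) * (f * x * e) * (e * f) = e * f * x * (e * f)"
    by (metis e f mult.assoc)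
  then have efx: "(e * f) * (f * x * e) * (e * f) = e * f" using x1 by simp
  have fxe: "(f * x * e) * (e * f) * (f * x * e) = f * x * e"
  proof -
    have "(f * x * e) * (e * f) * (f * x * e) = f * (x * (e * f) * x) * e"
      by (metis e f mult.assoc)
    then show ?thesis using x2 by simp
  qed
  have x: "f * x * e = x"
    using star_unique[OF efx fxe] unfolding x_def[symmetric] .
  have "x * x = f * (x * (e * f) * x) * e"
    by (subst (1 2) x[symmetric]) (simp add: mult.assoc)
  then have "x * x = x" using x x2 by simp
  then have "star x = x" by (rule star_idem)
  then have "e * f = x" unfolding x_def by simp
  with \<open>x * x = x\<close> show ?thesis by simp
qed

text \<open>Both products are idempotent, so \<open>f * e\<close> is an inverse of
  \<open>e * f\<close>, which is already its own inverse.\<close>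

lemma idem_commute:
  fixes e f :: 'a
  assumes e: "e * e = e" and f: "f * f = f"
  shows "e * f = f * e"
proof -
  note ef = idem_mult_idem[OF e f] and fe = idem_mult_idem[OF f e]
  have "(e * f) * (f * e) * (e * f) = (e * f) * (e * f)" "(f * e) * (e * f) * (f * e) = (f * e) * (f * e)"
    by (metis e f mult.assoc)+
  then have "f * e = star (e * f)" using ef fe star_unique by simp
  then show ?thesis using star_idem[OF ef] by simp
qed

text \<open>In a Clifford semigroup this is the index of the group that contains \<open>s\<close>,
  and the identity of that group.\<close>

definition rng :: "'a \<Rightarrow> 'a" where "rng s = s * star s"

lemma rng_idem: "rng s * rng s = rng s"
  unfolding rng_def by (metis mult.assoc star1)

lemma rng_left [simp]: "rng s * s = s" and rng_right [simp]: "s * rng s = s"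
  unfolding rng_def by (simp_all add: star1, metis mult.assoc star1 star_commute)

lemma rng_of_idem: "e * e = e \<Longrightarrow> rng e = e"
  unfolding rng_def by (simp add: star_idem)

text \<open>The Clifford condition for \<open>e * s\<close>, whose inverse is
  \<open>star s * e\<close>, gives \<open>e * rng s = star s * e * s\<close>. Multiplying by
  \<open>s\<close> on the left and absorbing \<open>rng s\<close> yields the claim.\<close>

lemma idem_central:
  fixes e s :: 'a
  assumes e: "e * e = e"
  shows "e * s = s * e"
proof -
  have c: "(e * s) * star (e * s) = star (e * s) * (e * s)" by (simp add: star_commute)
  have st: "star s * e = star (e * s)"
  proof (rule star_unique)
    have *: "e * rng s = rng s * e" using e rng_idem by (rule idem_commute)
    have "(e * s) * (star s * e) * (e * s) = e * rng s * e * s"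
      unfolding rng_def by (metis e mult.assoc)
    also have "\<dots> = e * s" by (metis * e mult.assoc rng_left)
    finally show "(e * s) * (star s * e) * (e * s) = e * s" .
    have "(star s * e) * (e * s) * (star s * e) = star s * e * rng s * e"
      unfolding rng_def by (metis e mult.assoc)
    also have "\<dots> = star s * rng s * e" by (metis * e mult.assoc)
    also have "\<dots> = star s * e" unfolding rng_def by (simp add: star2 mult.assoc[symmetric])
    finally show "(star s * e) * (e * s) * (star s * e) = star s * e" .
  qed
  have "e * rng s * e = star s * e * e * s"
    using c unfolding st[symmetric] rng_def by (simp add: mult.assoc)
  then have h: "e * rng s = star s * e * s"
    by (metis e idem_commute mult.assoc rng_idem)
  have "s * e * rng s = rng s * e * s"
    using arg_cong[OF h, of "\<lambda>x. s * x"] by (simp add: rng_def mult.assoc)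
  moreover have "s * e * rng s = s * e"
    by (metis e idem_commute mult.assoc rng_idem rng_right)
  moreover have "rng s * e * s = e * s"
    by (metis e idem_commute mult.assoc rng_idem rng_left)
  ultimately show ?thesis by simp
qed

lemma star_mult: "star (s * t) = star t * star s"
proof (rule star_unique[symmetric])
  have 1: "rng t * x = x * rng t" for t x using rng_idem by (rule idem_central)
  have "(s * t) * (star t * star s) * (s * t) = s * (rng t * rng s) * t"
    unfolding rng_def by (simp add: mult.assoc star_commute[symmetric])
      (simp add: mult.assoc[symmetric] star_commute)
  also have "\<dots> = s * t" by (metis 1 mult.assoc rng_left rng_right)
  finally show "(s * t) * (star t * star s) * (s * t) = s * t" .
  have "(star t * star s) * (s * t) * (star t * star s) = star t * (rng s * rng t) * star s"
    unfolding rng_def by (simp add: mult.assoc[symmetric]) (simp add: mult.assoc star_commute)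
  also have "\<dots> = star t * rng t * (rng s * star s)" by (metis 1 mult.assoc)
  also have "\<dots> = star t * star s"
    unfolding rng_def by (metis mult.assoc star2 star_commute)
  finally show "(star t * star s) * (s * t) * (star t * star s) = star t * star s" .
qed

text \<open>This is the semilattice grading: the product of elements of the groups at
  \<open>e\<close> and \<open>f\<close> lies in the group at \<open>e * f\<close>.\<close>

lemma rng_mult: "rng (s * t) = rng s * rng t"
proof -
  have "rng (s * t) = s * rng t * star s"
    unfolding rng_def by (simp add: star_mult mult.assoc)
  also have "\<dots> = rng t * rng s"
    by (metis idem_central rng_idem mult.assoc rng_def)
  also have "\<dots> = rng s * rng t"
    by (rule idem_commute[OF rng_idem rng_idem])
  finally show ?thesis .
qed

lemma rng_star: "rng (star s) = rng s"
  by (simp add: rng_def star_commute)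

text \<open>These weights define the character of \<open>\<ell>\<^sup>1(S)\<close> that extends the augmentation character of
  \<open>\<ell>\<^sup>1(G\<^sub>e)\<close>.\<close>

definition above_ind :: "'a \<Rightarrow> 'a \<Rightarrow> complex" where
  "above_ind e s = (if e * rng s = e then 1 else 0)"

lemma norm_above_ind: "\<forall>s. norm (above_ind e s) \<le> 1"
  by (simp add: above_ind_def)

text \<open>By \<open>rng_mult\<close>, the idempotent of a product is the meet of the two
  idempotents, and \<open>e\<close> lies below a meet exactly when it lies below both.\<close>

lemma above_ind_mult: "\<forall>s t. above_ind e (s * t) = above_ind e s * above_ind e t"
proof (intro allI)
  fix s t
  have "e * rng (s * t) = e \<longleftrightarrow> e * rng s = e \<and> e * rng t = e"
    unfolding rng_mult by (metis idem_commute mult.assoc rng_idem)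
  then show "above_ind e (s * t) = above_ind e s * above_ind e t"
    by (simp add: above_ind_def)
qed

text \<open>Translation by \<open>g\<close> permutes the group at \<open>e\<close>, with translation
  by \<open>star g\<close> as inverse, and the support of \<open>n\<close> never leaves this
  group.\<close>

lemma push_translation:
  assumes supp: "\<And>h. n h \<noteq> 0 \<Longrightarrow> rng h = e" and g: "rng g = e"
  shows "push (\<lambda>h. g * h) n k = (if rng k = e then n (star g * k) else 0)"
proof (cases "rng k = e")
  case True
  have "g * (star g * k) = k"
    using True g rng_left[of k] unfolding rng_def by (metis mult.assoc)
  moreover have "n t = 0" if "g * t = k" "t \<noteq> star g * k" for t
  proof (rule ccontr)
    assume "n t \<noteq> 0"
    then have "rng g * t = t" using supp g rng_left[of t] by simp
    then show False using that by (simp add: rng_def star_commute[symmetric] mult.assoc)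
  qed
  ultimately show ?thesis
    unfolding push_def using True by (subst infsum_single[of _ "star g * k"]) auto
next
  case False
  have "n t = 0" if "g * t = k" for t
    using that False supp[of t] g rng_mult[of g t] rng_idem[of g] by metis
  then have "infsum n {h. g * h = k} = 0" by (intro infsum_0) auto
  then show ?thesis
    unfolding push_def using False by simp
qed

text \<open>The projection of an \<open>\<ell>\<^sup>1(S)\<close>-almost invariant element of \<open>\<ell>\<^sup>1(S \<times> S)\<close> to \<open>\<ell>\<^sup>1(G\<^sub>e)\<close> is almost
  invariant; its normalised absolute value satisfies Reiter's condition.\<close>

lemma reiter_condition:
  assumes "approx_left_phi_biprojective (weighted_sum (above_ind e))"
    and e: "e * e = e" and K: "finite K" "\<And>g. g \<in> K \<Longrightarrow> rng g = e" and "\<epsilon> > 0"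
  obtains p where "p \<in> l1" "\<And>h. p h \<noteq> 0 \<Longrightarrow> rng h = e" "infsum p UNIV = 1" "l1norm p = 1"
    "\<And>g. g \<in> K \<Longrightarrow> l1norm (push (\<lambda>h. g * h) p - p) < \<epsilon>"
proof -
  let ?\<psi> = "above_ind e" and ?\<phi> = "weighted_sum (above_ind e)"
  obtain F :: "(('a \<Rightarrow> complex) \<Rightarrow> ('a \<times> 'a \<Rightarrow> complex)) filter" where
    F: "F \<noteq> bot" "\<forall>\<^sub>F \<rho> in F. bounded_linear_l1 \<rho>"
    and lim: "\<And>a x. a \<in> l1 \<Longrightarrow> x \<in> l1 \<Longrightarrow>
        ((\<lambda>\<rho>. l1norm (lact a (\<rho> x) - \<rho> (conv a x))) \<longlongrightarrow> 0) F"
      "\<And>a x. a \<in> l1 \<Longrightarrow> x \<in> l1 \<Longrightarrow>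
        ((\<lambda>\<rho>. l1norm (\<rho> (conv x a) - (\<lambda>p. ?\<phi> a * \<rho> x p))) \<longlongrightarrow> 0) F"
      "\<And>x. x \<in> l1 \<Longrightarrow> ((\<lambda>\<rho>. ?\<phi> (diag_pi (\<rho> x)) - ?\<phi> x) \<longlongrightarrow> 0) F"
    using assms(1) unfolding approx_left_phi_biprojective_def fun_diff_def by blast
  have rng_e: "rng e = e" using e by (rule rng_of_idem)
  have ge: "g * e = g" "e * g = g" if "rng g = e" for g
    using that rng_left[of g] rng_right[of g] by simp_all
  have e4: "\<epsilon> / 4 > 0" using assms(5) by simp
  \<comment> \<open>Since \<open>g * e = g = e * g\<close> and the character is \<open>1\<close> at
    \<open>delta g\<close>, the first two conditions make \<open>\<rho> (delta g)\<close> close both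
    to the left translate of \<open>\<rho> (delta e)\<close> by \<open>g\<close> and to
    \<open>\<rho> (delta e)\<close> itself.\<close>
  have ev1: "\<forall>\<^sub>F \<rho> in F. \<forall>g\<in>K. l1norm (lact (delta g) (\<rho> (delta e)) - \<rho> (delta g)) < \<epsilon> / 4"
  proof (rule eventually_ball_finite[OF K(1)], intro ballI)
    fix g assume "g \<in> K"
    then show "\<forall>\<^sub>F \<rho> in F. l1norm (lact (delta g) (\<rho> (delta e)) - \<rho> (delta g)) < \<epsilon> / 4"
      using order_tendstoD(2)[OF lim(1)[of "delta g" "delta e"] e4] K(2) ge by simp
  qed
  have ev2: "\<forall>\<^sub>F \<rho> in F. \<forall>g\<in>K. l1norm (\<rho> (delta g) - \<rho> (delta e)) < \<epsilon> / 4"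
  proof (rule eventually_ball_finite[OF K(1)], intro ballI)
    fix g assume "g \<in> K"
    then show "\<forall>\<^sub>F \<rho> in F. l1norm (\<rho> (delta g) - \<rho> (delta e)) < \<epsilon> / 4"
      using order_tendstoD(2)[OF lim(2)[of "delta g" "delta e"] e4] K(2) ge e
      by (simp add: above_ind_def)
  qed
  have ev3: "\<forall>\<^sub>F \<rho> in F. norm (?\<phi> (diag_pi (\<rho> (delta e))) - 1) < 1 / 2"
    using order_tendstoD(2)[OF tendsto_norm_zero[OF lim(3)[of "delta e"]], of "1/2"] e rng_e
    by (simp add: above_ind_def)
  obtain \<rho> where \<rho>: "bounded_linear_l1 \<rho>"
    "\<And>g. g \<in> K \<Longrightarrow> l1norm (lact (delta g) (\<rho> (delta e)) - \<rho> (delta g)) < \<epsilon> / 4"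
    "\<And>g. g \<in> K \<Longrightarrow> l1norm (\<rho> (delta g) - \<rho> (delta e)) < \<epsilon> / 4"
    "norm (?\<phi> (diag_pi (\<rho> (delta e))) - 1) < 1 / 2"
    using eventually_happens'[OF F(1) eventually_conj[OF F(2) eventually_conj[OF ev1
          eventually_conj[OF ev2 ev3]]]] by blast
  define m where "m = \<rho> (delta e)"
  have m: "m \<in> l1" and \<rho>g: "\<And>g. \<rho> (delta g) \<in> l1"
    unfolding m_def by (simp_all add: bounded_linear_l1_in[OF \<rho>(1)])
  define W where "W p = ?\<psi> (fst p) * ?\<psi> (snd p)" for p
  have W: "\<forall>p. norm (W p) \<le> 1" by (simp add: W_def above_ind_def)
  \<comment> \<open>\<open>R\<close> discards pairs with a coordinate whose idempotent is not above
    \<open>e\<close>, moves the first coordinate into the group at \<open>e\<close>, and sums out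
    the second. It is contractive since \<open>W\<close> is bounded by \<open>1\<close>.\<close>
  define R where "R k = push (\<lambda>p. e * fst p) (\<lambda>p. W p * k p)" for k :: "'a \<times> 'a \<Rightarrow> complex"
  have Wk: "(\<lambda>p. W p * k p) \<in> l1" "l1norm (\<lambda>p. W p * k p) \<le> l1norm k" if "k \<in> l1" for k
    using l1_mult_bounded[OF that W] by simp_all
  have R: "R k \<in> l1" "l1norm (R k) \<le> l1norm k" if "k \<in> l1" for k
    using Wk[OF that] l1norm_push[OF Wk(1)[OF that], of "\<lambda>p. e * fst p"] by (simp_all add: R_def)
  have R_diff: "R (k - l) = R k - R l" if "k \<in> l1" "l \<in> l1" for k l
  proof -
    have "(\<lambda>p. W p * (k - l) p) = (\<lambda>p. W p * k p) - (\<lambda>p. W p * l p)"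
      by (auto simp: algebra_simps)
    then show ?thesis
      unfolding R_def by (simp only:) (intro push_diff Wk that)
  qed
  \<comment> \<open>Equivariance holds because \<open>e\<close> is central and \<open>W\<close> does
    not change when the first coordinate is multiplied by \<open>g\<close>.\<close>
  have R_lact: "R (lact (delta g) k) = push (\<lambda>h. g * h) (R k)" if k: "k \<in> l1" and g: "rng g = e" for k g
  proof -
    let ?F = "\<lambda>p. (g * fst p, snd p)"
    have ac: "e * (g * w) = g * (e * w)" for w
      by (metis e idem_central mult.assoc)
    have WF: "W (?F p) = W p" for p
    proof -
      have "above_ind e (g * fst p) = above_ind e (fst p)"
        using g e by (simp add: above_ind_def rng_mult mult.assoc[symmetric])
      then show ?thesis by (simp add: W_def)
    qed
    have "R (lact (delta g) k) = push (\<lambda>p. e * fst p) (\<lambda>p. W p * push ?F k p)"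
      unfolding R_def lact_delta[OF k] by (simp add: case_prod_unfold)
    also have "\<dots> = push (\<lambda>p. e * fst p) (push ?F (\<lambda>p. W p * k p))"
      using push_mult[of ?F W k] unfolding WF by simp
    also have "\<dots> = push (\<lambda>p. g * (e * fst p)) (\<lambda>p. W p * k p)"
      using Wk(1)[OF k] by (simp add: push_push ac)
    also have "\<dots> = push (\<lambda>h. g * h) (R k)"
      using Wk(1)[OF k] by (simp add: R_def push_push)
    finally show ?thesis .
  qed
  define n where "n = R m"
  have n: "n \<in> l1" unfolding n_def using m by (rule R)
  have n_supp: "rng h = e" if "n h \<noteq> 0" for h
  proof (rule ccontr)
    assume h: "rng h \<noteq> e"
    have "W p * m p = 0" if "e * fst p = h" for p
    proof -
      have "above_ind e (fst p) = 0"
        using h that rng_e rng_mult[of e "fst p"] by (auto simp: above_ind_def)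
      then show ?thesis by (simp add: W_def)
    qed
    then have "n h = 0" unfolding n_def R_def push_def by (intro infsum_0) auto
    with that show False by simp
  qed
  \<comment> \<open>As the weight is multiplicative, the total mass of \<open>n\<close> is the
    character of \<open>diag_pi m\<close>, which is close to \<open>1\<close>. So the norm of
    \<open>n\<close> exceeds \<open>1 / 2\<close>, and normalising costs at most a factor
    \<open>2\<close>.\<close>
  have "infsum n UNIV = weighted_sum (\<lambda>p. ?\<psi> (fst p * snd p)) m"
    unfolding n_def R_def infsum_push[OF Wk(1)[OF m]]
    by (simp add: weighted_sum_def W_def above_ind_mult[rule_format])
  also have "\<dots> = ?\<phi> (diag_pi m)"
    unfolding diag_pi_push by (simp add: weighted_sum_push[OF m norm_above_ind] case_prod_unfold)
  finally have "norm (infsum n UNIV - 1) < 1 / 2" using \<rho>(4) by (simp add: m_def)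
  then have "1 / 2 < norm (infsum n UNIV)"
    using norm_triangle_ineq2[of 1 "1 - infsum n UNIV"] by (simp add: norm_minus_commute)
  then have \<nu>: "1 / 2 < l1norm n" using norm_infsum_le_l1norm[OF n, of UNIV] by simp
  have n_inv: "l1norm (push (\<lambda>h. g * h) n - n) < \<epsilon> / 2" if g: "g \<in> K" for g
  proof -
    have "push (\<lambda>h. g * h) n - n = R (lact (delta g) m - m)"
      unfolding n_def by (simp add: R_diff m R_lact K(2)[OF g])
    also have "lact (delta g) m - m = (lact (delta g) m - \<rho> (delta g)) + (\<rho> (delta g) - m)"
      by simp
    finally have "l1norm (push (\<lambda>h. g * h) n - n) \<le>
        l1norm ((lact (delta g) m - \<rho> (delta g)) + (\<rho> (delta g) - m))"
      by (simp only:) (intro R l1_add l1_diff lact_l1 m \<rho>g delta_l1)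
    also have "\<dots> \<le> l1norm (lact (delta g) m - \<rho> (delta g)) + l1norm (\<rho> (delta g) - m)"
      by (intro l1norm_add l1_diff lact_l1 m \<rho>g delta_l1)
    also have "\<dots> < \<epsilon> / 2" using \<rho>(2,3)[OF g] unfolding m_def by simp
    finally show ?thesis .
  qed
  define p where "p = (\<lambda>h. complex_of_real (inverse (l1norm n)) * complex_of_real (norm (n h)))"
  have abs_n: "(\<lambda>h. complex_of_real (norm (n h))) \<in> l1"
    "l1norm (\<lambda>h. complex_of_real (norm (n h))) = l1norm n"
    using n by (simp_all add: l1_def l1norm_def)
  show ?thesis
  proof (rule that[of p])
    show "p \<in> l1" unfolding p_def using abs_n(1) by (rule l1_cmult)
    show "rng h = e" if "p h \<noteq> 0" for h using that n_supp[of h] by (auto simp: p_def)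
    show "l1norm p = 1"
      unfolding p_def l1norm_cmult abs_n(2) norm_of_real using \<nu> by simp
    have "infsum (\<lambda>h. complex_of_real (norm (n h))) UNIV = complex_of_real (l1norm n)"
      unfolding l1norm_def using has_sum_of_real[OF has_sum_infsum[OF l1D[OF n]]] infsumI by blast
    then show "infsum p UNIV = 1"
      unfolding p_def infsum_cmult_right' using \<nu> by (simp add: of_real_mult[symmetric] del: of_real_mult)
    fix g assume g: "g \<in> K"
    let ?d = "push (\<lambda>h. g * h) n - n"
    \<comment> \<open>Translation permutes the group, so it commutes with pointwise absolute values;
      the reverse triangle inequality then bounds the defect of \<open>p\<close> by that of
      \<open>n\<close>.\<close>
    have eq: "push (\<lambda>h. g * h) p - p = (\<lambda>k. complex_of_real (inverse (l1norm n)) *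
        complex_of_real (norm (push (\<lambda>h. g * h) n k) - norm (n k)))"
    proof
      fix k
      have "push (\<lambda>h. g * h) p k = (if rng k = e then p (star g * k) else 0)"
        by (rule push_translation) (use n_supp K(2)[OF g] in \<open>auto simp: p_def\<close>)
      moreover have "push (\<lambda>h. g * h) n k = (if rng k = e then n (star g * k) else 0)"
        by (rule push_translation) (use n_supp K(2)[OF g] in auto)
      ultimately show "(push (\<lambda>h. g * h) p - p) k = complex_of_real (inverse (l1norm n)) *
        complex_of_real (norm (push (\<lambda>h. g * h) n k) - norm (n k))"
        by (simp add: p_def algebra_simps)
    qed
    have d: "?d \<in> l1" using n by simp
    have "l1norm (\<lambda>k. complex_of_real (norm (push (\<lambda>h. g * h) n k) - norm (n k))) \<le> l1norm ?d"
      unfolding l1norm_def[of ?d]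
      by (rule l1_comparison(2)[OF l1D[OF d]]) (simp add: norm_triangle_ineq3 del: of_real_diff)
    then have "l1norm (push (\<lambda>h. g * h) p - p) \<le> inverse (l1norm n) * l1norm ?d"
      unfolding eq l1norm_cmult norm_of_real
      by (simp add: mult_left_mono del: of_real_diff)
    also have "\<dots> \<le> 2 * l1norm ?d"
      using \<nu> by (intro mult_right_mono) (simp_all add: field_simps)
    also have "\<dots> < \<epsilon>" using n_inv[OF g] by simp
    finally show "l1norm (push (\<lambda>h. g * h) p - p) < \<epsilon>" .
  qed
qed

end

section \<open>Central idempotents of the convolution algebra\<close>

lemma bounded_linear_l1_conv_left: "b \<in> l1 \<Longrightarrow> bounded_linear_l1 (\<lambda>a. conv a b)"
  by (rule bounded_linear_l1I[where C = "l1norm b"])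
    (simp_all add: conv_add_left conv_cmult_left mult.commute[of "l1norm b"] l1norm_conv)

lemma bounded_linear_l1_conv_right: "a \<in> l1 \<Longrightarrow> bounded_linear_l1 (conv a)"
  by (rule bounded_linear_l1I[where C = "l1norm a"])
    (simp_all add: conv_add_right conv_cmult_right l1norm_conv)

lemma bounded_linear_l1_lact_left: "m \<in> l1 \<Longrightarrow> bounded_linear_l1 (\<lambda>a. lact a m)"
  by (rule bounded_linear_l1I[where C = "l1norm m"])
    (simp_all add: lact_add_left lact_cmult_left mult.commute[of "l1norm m"] l1norm_lact)

lemma bounded_linear_l1_lact_right: "a \<in> l1 \<Longrightarrow> bounded_linear_l1 (lact a)"
  by (rule bounded_linear_l1I[where C = "l1norm a"])
    (simp_all add: lact_add_right lact_cmult_right l1norm_lact)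

lemma bounded_linear_l1_ract_left: "a \<in> l1 \<Longrightarrow> bounded_linear_l1 (\<lambda>m. ract m a)"
  by (rule bounded_linear_l1I[where C = "l1norm a"])
    (simp_all add: ract_add_left ract_cmult_left mult.commute[of "l1norm a"] l1norm_ract)

lemma bounded_linear_l1_ract_right: "m \<in> l1 \<Longrightarrow> bounded_linear_l1 (ract m)"
  by (rule bounded_linear_l1I[where C = "l1norm m"])
    (simp_all add: ract_add_right ract_cmult_right l1norm_ract)

lemma bounded_linear_l1_push: "bounded_linear_l1 (push f)"
  by (rule bounded_linear_l1I[where C = 1]) (simp_all add: push_add push_cmult l1norm_push)

lemma bounded_linear_l1_minus:
  assumes "bounded_linear_l1 T" "f \<in> l1" "g \<in> l1"
  shows "T (f - g) = T f - T g"
  using bounded_linear_l1_add[OF assms(1) l1_diff[OF assms(2,3)] assms(3)] by simp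

lemma bounded_linear_l1_zero: "bounded_linear_l1 T \<Longrightarrow> T 0 = 0"
  using bounded_linear_l1_minus[of T 0 0] by simp

lemmas conv_diff_left = bounded_linear_l1_minus[OF bounded_linear_l1_conv_left]
  and conv_diff_right = bounded_linear_l1_minus[OF bounded_linear_l1_conv_right]
  and conv_sum_left = bounded_linear_l1_sum[OF bounded_linear_l1_conv_left]
  and conv_sum_right = bounded_linear_l1_sum[OF bounded_linear_l1_conv_right]
  and conv_zero_left = bounded_linear_l1_zero[OF bounded_linear_l1_conv_left]
  and conv_zero_right = bounded_linear_l1_zero[OF bounded_linear_l1_conv_right]

section \<open>The idempotents below a given idempotent\<close>

context clifford
begin

definition below :: "'a \<Rightarrow> 'a set" where
  "below e = {f. f * f = f \<and> f * e = f}"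

text \<open>Anything below an idempotent is a product of two idempotents, hence itself
  idempotent.\<close>

lemma down_set_idem:
  assumes "e * e = e"
  shows "down_set star e = below e"
proof (intro set_eqI iffI)
  fix f assume "f \<in> down_set star e"
  then have f: "f = rng f * e" by (simp add: down_set_def sg_le_def rng_def)
  have "f * f = f" using idem_mult_idem[OF rng_idem assms] f by metis
  moreover have "f * e = f" using f assms by (metis mult.assoc)
  ultimately show "f \<in> below e" by (simp add: below_def)
next
  fix f assume "f \<in> below e"
  then show "f \<in> down_set star e"
    using rng_of_idem[of f] by (simp add: below_def down_set_def sg_le_def rng_def)
qed

end

locale ulf_clifford = clifford +
  fixes N :: nat
  assumes ulf: "e * e = e \<Longrightarrow> finite (below e) \<and> card (below e) \<le> N"
begin

lemma finite_below: "e * e = e \<Longrightarrow> finite (below e)"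
  and card_below: "e * e = e \<Longrightarrow> card (below e) \<le> N"
  using ulf by auto

text \<open>This supplies the measure for all inductions down the semilattice.\<close>

lemma card_below_less:
  assumes e: "e * e = e" and f: "f \<in> below e - {e}"
  shows "card (below f) < card (below e)"
proof (rule psubset_card_mono[OF finite_below[OF e]])
  have f': "f * f = f" "f * e = f" "f \<noteq> e" using f by (auto simp: below_def)
  have "g * e = g" if "g * f = g" for g using that f' by (metis mult.assoc)
  moreover have "e \<notin> below f" using f' idem_commute[OF e f'(1)] by (auto simp: below_def)
  moreover have "e \<in> below e" using e by (simp add: below_def)
  ultimately show "below f \<subset> below e" by (auto simp: below_def)
qed

text \<open>The idempotent \<open>\<Sum>\<^bsub>f \<le> e\<^esub> \<mu>(f, e) \<delta>\<^sub>f\<close> cutting the ideal \<open>\<ell>\<^sup>1(G\<^sub>e)\<close> out of \<open>\<ell>\<^sup>1(S)\<close> satisfies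
  \<open>P\<^sub>e = \<delta>\<^sub>e - \<Sum>\<^bsub>f < e\<^esub> P\<^sub>f\<close>. Chains in \<open>E(S)\<close> have at most \<open>N\<close> elements, so unrolling this
  recursion \<open>N\<close> times suffices.\<close>

primrec moebius_iter :: "nat \<Rightarrow> 'a \<Rightarrow> 'a \<Rightarrow> complex" where
  "moebius_iter 0 e = 0"
| "moebius_iter (Suc n) e = delta e - (\<Sum>f\<in>below e - {e}. moebius_iter n f)"

definition proj :: "'a \<Rightarrow> 'a \<Rightarrow> complex" where
  "proj = moebius_iter N"

text \<open>Each strict descent lowers the cardinality of \<open>below\<close>, so the recursion
  bottoms out within that many unrollings.\<close>

lemma moebius_iter_stable:
  "e * e = e \<Longrightarrow> card (below e) \<le> n \<Longrightarrow> moebius_iter (Suc n) e = moebius_iter n e"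
proof (induction n arbitrary: e)
  case 0
  \<comment> \<open>The base case is contradictory, as \<open>e\<close> belongs to
    \<open>below e\<close>.\<close>
  then have "below e = {}" using finite_below[of e] by simp
  moreover have "e \<in> below e" using 0 by (simp add: below_def)
  ultimately show ?case by simp
next
  case (Suc n)
  have "moebius_iter (Suc n) f = moebius_iter n f" if "f \<in> below e - {e}" for f
    using that card_below_less[OF Suc.prems(1) that] Suc.prems(2)
    by (intro Suc.IH) (auto simp: below_def)
  then have "(\<Sum>f\<in>below e - {e}. moebius_iter (Suc n) f) = (\<Sum>f\<in>below e - {e}. moebius_iter n f)"
    by (rule sum.cong[OF refl])
  then show ?case by (simp only: moebius_iter.simps(2)[of "Suc n"] moebius_iter.simps(2)[of n e])
qed

lemma proj_rec: "e * e = e \<Longrightarrow> proj e = delta e - (\<Sum>f\<in>below e - {e}. proj f)"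
  unfolding proj_def using moebius_iter_stable[OF _ card_below, of e] by simp

lemma moebius_iter_l1: "moebius_iter n e \<in> l1"
  by (induction n arbitrary: e) (simp_all add: l1_sum)

lemma proj_l1 [simp]: "proj e \<in> l1"
  unfolding proj_def by (rule moebius_iter_l1)

text \<open>The recursion contributes \<open>1 + N * (N + 1) ^ n\<close>, which is at most
  \<open>(N + 1) ^ Suc n\<close>. Independence of \<open>e\<close> is what makes the later bounds
  uniform.\<close>

lemma l1norm_moebius_iter: "e * e = e \<Longrightarrow> l1norm (moebius_iter n e) \<le> (real N + 1) ^ n"
proof (induction n arbitrary: e)
  case (Suc n)
  let ?S = "\<Sum>f\<in>below e - {e}. moebius_iter n f"
  have "l1norm (moebius_iter (Suc n) e) \<le> l1norm (delta e) + l1norm ?S"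
    unfolding moebius_iter.simps by (intro l1norm_diff l1_sum moebius_iter_l1 delta_l1)
  moreover have "l1norm ?S \<le> (\<Sum>f\<in>below e - {e}. l1norm (moebius_iter n f))"
    by (intro l1norm_sum moebius_iter_l1)
  moreover have "\<dots> \<le> (\<Sum>f\<in>below e - {e}. (real N + 1) ^ n)"
    by (intro sum_mono Suc.IH) (auto simp: below_def)
  moreover have "\<dots> \<le> real N * (real N + 1) ^ n"
    using card_below[OF Suc.prems] card_Diff1_le[of "below e" e]
    by (simp add: mult_right_mono)
  moreover have "1 \<le> (real N + 1) ^ n" by simp
  moreover have "(real N + 1) ^ Suc n = (real N + 1) ^ n + real N * (real N + 1) ^ n"
    by (simp add: algebra_simps)
  moreover have "l1norm (delta e) = 1" by simp
  ultimately show ?case by linarith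
qed simp

definition proj_bound :: real where "proj_bound = (real N + 1) ^ N"

lemma l1norm_proj: "e * e = e \<Longrightarrow> l1norm (proj e) \<le> proj_bound"
  unfolding proj_def proj_bound_def by (rule l1norm_moebius_iter)

lemma proj_bound_nonneg: "0 \<le> proj_bound"
  unfolding proj_bound_def by simp

text \<open>Moebius inversion, obtained by moving the sum in \<open>proj_rec\<close> to the other
  side. At \<open>e = rng s\<close> it shows that these projections together fix
  \<open>delta s\<close>.\<close>

lemma sum_proj:
  assumes "e * e = e"
  shows "(\<Sum>f\<in>below e. proj f) = delta e"
proof -
  have "(\<Sum>f\<in>below e. proj f) = proj e + (\<Sum>f\<in>below e - {e}. proj f)"
    using assms by (intro sum.remove finite_below) (simp_all add: below_def)
  then show ?thesis using proj_rec[OF assms] by simp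
qed

lemma proj_central:
  assumes "e * e = e"
  shows "conv (proj e) (delta s) = conv (delta s) (proj e)"
proof -
  have "e * e = e \<Longrightarrow> conv (moebius_iter n e) (delta s) = conv (delta s) (moebius_iter n e)" for n e
  proof (induction n arbitrary: e)
    case 0
    show ?case
      by (simp only: moebius_iter.simps conv_zero_left conv_zero_right delta_l1)
  next
    case (Suc n)
    have "(\<Sum>f\<in>below e - {e}. conv (moebius_iter n f) (delta s)) =
        (\<Sum>f\<in>below e - {e}. conv (delta s) (moebius_iter n f))"
      by (intro sum.cong refl Suc.IH) (auto simp: below_def)
    then have "conv (delta e - (\<Sum>f\<in>below e - {e}. moebius_iter n f)) (delta s) =
        conv (delta s) (delta e - (\<Sum>f\<in>below e - {e}. moebius_iter n f))"
      using idem_central[OF Suc.prems, of s]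
      by (simp add: conv_diff_left conv_diff_right conv_sum_left conv_sum_right moebius_iter_l1 l1_sum)
    then show ?case by (simp only: moebius_iter.simps)
  qed
  then show ?thesis unfolding proj_def using assms by blast
qed

text \<open>Induction down the semilattice: the recursion and the induction hypothesis leave
  \<open>delta (e * f)\<close> minus the sum of \<open>proj g\<close> over \<open>g < e\<close> with
  \<open>g\<close> below \<open>f\<close>. If \<open>e\<close> is below \<open>f\<close>, this is
  the recursion for \<open>proj e\<close>; otherwise these \<open>g\<close> are exactly the elements
  of \<open>below (e * f)\<close>, and \<open>sum_proj\<close> cancels everything.\<close>

lemma proj_conv_idem:
  assumes "e * e = e" "f * f = f"
  shows "conv (proj e) (delta f) = (if e * f = e then proj e else 0)"
  using assms(1)
proof (induction "card (below e)" arbitrary: e rule: less_induct)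
  case (less e)
  note e = less.prems
  have IH: "conv (proj g) (delta f) = (if g * f = g then proj g else 0)" if "g \<in> below e - {e}" for g
    using less.hyps[OF card_below_less[OF e that]] that by (simp add: below_def)
  have "conv (proj e) (delta f) = delta (e * f) - (\<Sum>g\<in>below e - {e}. conv (proj g) (delta f))"
    by (subst proj_rec[OF e]) (simp add: conv_diff_left conv_sum_left l1_sum)
  also have "(\<Sum>g\<in>below e - {e}. conv (proj g) (delta f)) =
      (\<Sum>g\<in>below e - {e}. if g * f = g then proj g else 0)"
    by (intro sum.cong refl IH)
  also have "\<dots> = (\<Sum>g | g \<in> below e - {e} \<and> g * f = g. proj g)"
    using finite_below[OF e] by (intro sum.inter_filter[symmetric]) simp
  also have "delta (e * f) - \<dots> = (if e * f = e then proj e else 0)"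
  proof (cases "e * f = e")
    case True
    have "g * f = g" if "g \<in> below e" for g
      using that True unfolding below_def by (metis (mono_tags, lifting) mem_Collect_eq mult.assoc)
    then have "{g. g \<in> below e - {e} \<and> g * f = g} = below e - {e}" by auto
    with True show ?thesis by (simp add: proj_rec[OF e, symmetric])
  next
    case False
    have "{g. g \<in> below e - {e} \<and> g * f = g} = below (e * f)"
    proof (intro set_eqI iffI)
      fix g assume "g \<in> {g. g \<in> below e - {e} \<and> g * f = g}"
      then show "g \<in> below (e * f)" by (auto simp: below_def mult.assoc[symmetric])
    next
      fix g assume "g \<in> below (e * f)"
      then have g: "g * g = g" "g * (e * f) = g" by (auto simp: below_def)
      have "g * e = g" using g(2) e idem_commute[OF e assms(2)] by (metis mult.assoc)
      moreover have "g * f = g" using g(2) assms(2) by (metis mult.assoc)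
      ultimately show "g \<in> {g. g \<in> below e - {e} \<and> g * f = g}"
        using g(1) False by (auto simp: below_def)
    qed
    then show ?thesis
      using False sum_proj[OF idem_mult_idem[OF e assms(2)]] by simp
  qed
  finally show ?case .
qed

text \<open>\<open>proj e\<close> absorbs \<open>delta e\<close>, which replaces \<open>s\<close> by
  \<open>e * s\<close>, and it annihilates \<open>delta (rng s)\<close> unless \<open>e\<close> is
  below \<open>rng s\<close>.\<close>

lemma proj_conv_delta:
  assumes "e * e = e"
  shows "conv (proj e) (delta s) = (if e * rng s = e then conv (proj e) (delta (e * s)) else 0)"
proof -
  have 1: "conv (conv (proj e) (delta (rng s))) (delta s) = conv (proj e) (delta s)"
    by (simp add: conv_assoc)
  have 2: "conv (conv (proj e) (delta e)) (delta s) = conv (proj e) (delta (e * s))"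
    by (simp add: conv_assoc)
  show ?thesis
  proof (cases "e * rng s = e")
    case True
    have "conv (proj e) (delta e) = proj e" using proj_conv_idem[OF assms assms] assms by simp
    with 2 True show ?thesis by simp
  next
    case False
    then have "conv (proj e) (delta (rng s)) = 0" using proj_conv_idem[OF assms rng_idem] by simp
    with 1 False show ?thesis by (simp add: conv_zero_left)
  qed
qed

lemma delta_conv_proj: "e * e = e \<Longrightarrow> conv (delta e) (proj e) = proj e"
  using proj_central[of e e] proj_conv_idem[of e e] by simp

text \<open>For \<open>f < e\<close>, \<open>proj e\<close> annihilates \<open>delta f\<close> and
  hence \<open>proj f\<close>, which equals \<open>conv (delta f) (proj f)\<close>. In the recursion
  for the second factor only \<open>delta e\<close> survives.\<close>

lemma proj_conv_proj:
  assumes e: "e * e = e"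
  shows "conv (proj e) (proj e) = proj e"
proof -
  have "conv (proj e) (proj f) = 0" if "f \<in> below e - {e}" for f
  proof -
    have f: "f * f = f" "f * e = f" "f \<noteq> e" using that by (auto simp: below_def)
    then have "conv (proj e) (delta f) = 0"
      using proj_conv_idem[OF e f(1)] idem_commute[OF e f(1)] by simp
    then have "conv (conv (proj e) (delta f)) (proj f) = 0" by (simp add: conv_zero_left)
    then show ?thesis by (simp add: conv_assoc delta_conv_proj f(1))
  qed
  then have "conv (proj e) (\<Sum>f\<in>below e - {e}. proj f) = 0"
    by (simp add: conv_sum_right)
  moreover have "conv (proj e) (delta e - (\<Sum>f\<in>below e - {e}. proj f)) =
      conv (proj e) (delta e) - conv (proj e) (\<Sum>f\<in>below e - {e}. proj f)"
    by (intro conv_diff_right) (simp_all add: l1_sum)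
  ultimately show ?thesis
    unfolding proj_rec[OF e, symmetric] using proj_conv_idem[OF e e] e by simp
qed

text \<open>An element \<open>p\<close> of \<open>\<ell>\<^sup>1(G\<^sub>e)\<close> that satisfies Reiter's condition gives the approximate diagonal
  \<open>\<Sum>\<^sub>g p(g) \<delta>\<^sub>g \<otimes> \<delta>\<^bsub>g\<^sup>*\<^esub>\<close> of \<open>\<ell>\<^sup>1(G\<^sub>e)\<close>.\<close>

definition group_diag :: "('a \<Rightarrow> complex) \<Rightarrow> 'a \<times> 'a \<Rightarrow> complex" where
  "group_diag p = push (\<lambda>g. (g, star g)) p"

text \<open>Uncut, the group diagonal would be moved out of the group at \<open>e\<close> by any
  \<open>s\<close> whose idempotent is not above \<open>e\<close>; after the cut such
  \<open>s\<close> act as zero on both sides.\<close>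

definition diag_at :: "'a \<Rightarrow> ('a \<Rightarrow> complex) \<Rightarrow> 'a \<times> 'a \<Rightarrow> complex" where
  "diag_at e p = lact (proj e) (ract (group_diag p) (proj e))"

context
  fixes e :: 'a and p :: "'a \<Rightarrow> complex"
  assumes e: "e * e = e" and p: "p \<in> l1" "\<And>h. p h \<noteq> 0 \<Longrightarrow> rng h = e"
    "infsum p UNIV = 1" "l1norm p = 1"
begin

lemma group_diag_l1 [simp]: "group_diag p \<in> l1"
  using p(1) by (simp add: group_diag_def)

lemma diag_at_l1 [simp]: "diag_at e p \<in> l1"
  by (simp add: diag_at_def)

lemma diag_pi_group_diag: "diag_pi (group_diag p) = delta e"
proof -
  have "diag_pi (group_diag p) = push (\<lambda>g. g * star g) p"
    using p(1) by (simp add: diag_pi_push group_diag_def push_push)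
  also have "\<dots> = push (\<lambda>_. e) p"
    using p(2) by (intro push_cong) (simp add: rng_def)
  also have "\<dots> = delta e"
    using p(3) by (auto simp: push_def delta_def)
  finally show ?thesis .
qed

lemma diag_pi_diag_at: "diag_pi (diag_at e p) = proj e"
  unfolding diag_at_def
  by (simp add: diag_pi_lact diag_pi_ract diag_pi_group_diag delta_conv_proj proj_conv_proj e)

text \<open>Substituting \<open>h\<close> for \<open>g * h\<close> in the left action writes both
  terms as push-forwards along one map, so the commutator is controlled by the translation defect of
  \<open>p\<close>.\<close>

lemma group_diag_commutator:
  assumes g: "rng g = e"
  shows "lact (delta g) (group_diag p) - ract (group_diag p) (delta g) =
    push (\<lambda>h. (h, star h * g)) (push (\<lambda>h. g * h) p - p)"
proof -
  have "lact (delta g) (group_diag p) = push (\<lambda>h. (g * h, star h)) p"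
    unfolding lact_delta[OF group_diag_l1] using p(1) by (simp add: group_diag_def push_push)
  also have "\<dots> = push (\<lambda>h. (g * h, star (g * h) * g)) p"
  proof (rule push_cong)
    fix h assume "p h \<noteq> 0"
    then have "star h * e = star h" using p(2) rng_star[of h] rng_right[of "star h"] by simp
    then have "star (g * h) * g = star h"
      using g by (simp add: star_mult mult.assoc star_commute rng_def)
    then show "(g * h, star h) = (g * h, star (g * h) * g)" by simp
  qed
  also have "\<dots> = push (\<lambda>h. (h, star h * g)) (push (\<lambda>h. g * h) p)"
    using p(1) by (simp add: push_push)
  moreover have "ract (group_diag p) (delta g) = push (\<lambda>h. (h, star h * g)) p"
    unfolding ract_delta[OF group_diag_l1] using p(1) by (simp add: group_diag_def push_push)
  ultimately show ?thesis using p(1) by (simp add: push_diff)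
qed

text \<open>As \<open>proj e\<close> is central, \<open>delta s\<close> can be moved next to it on
  either side, where \<open>proj_conv_delta\<close> replaces \<open>s\<close> by
  \<open>e * s\<close> or gives zero.\<close>

lemma diag_at_commutator:
  "lact (delta s) (diag_at e p) - ract (diag_at e p) (delta s) =
    (if e * rng s = e then lact (proj e) (ract (lact (delta (e * s)) (group_diag p) -
       ract (group_diag p) (delta (e * s))) (proj e)) else 0)"
proof -
  let ?P = "proj e" and ?D = "group_diag p"
  have L: "lact (delta s) (diag_at e p) = lact (conv ?P (delta s)) (ract ?D ?P)"
    unfolding diag_at_def by (simp add: lact_lact proj_central e)
  have R: "ract (diag_at e p) (delta s) = lact ?P (ract ?D (conv ?P (delta s)))"
    unfolding diag_at_def by (simp add: ract_ract lact_ract[symmetric])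
  show ?thesis
  proof (cases "e * rng s = e")
    case True
    have P: "conv ?P (delta s) = conv ?P (delta (e * s))"
      using proj_conv_delta[OF e, of s] True by simp
    have "lact (delta s) (diag_at e p) = lact ?P (ract (lact (delta (e * s)) ?D) ?P)"
      unfolding L P by (simp add: lact_lact[symmetric] lact_ract)
    moreover have "ract (diag_at e p) (delta s) = lact ?P (ract (ract ?D (delta (e * s))) ?P)"
      unfolding R P by (simp add: ract_ract proj_central e)
    ultimately show ?thesis
      using True
      by (simp add: bounded_linear_l1_minus[OF bounded_linear_l1_ract_left]
          bounded_linear_l1_minus[OF bounded_linear_l1_lact_right])
  next
    case False
    then have "conv ?P (delta s) = 0" using proj_conv_delta[OF e, of s] by simp
    then show ?thesis
      using False unfolding L R
      by (simp add: bounded_linear_l1_zero[OF bounded_linear_l1_lact_left]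
          bounded_linear_l1_zero[OF bounded_linear_l1_lact_right]
          bounded_linear_l1_zero[OF bounded_linear_l1_ract_right])
  qed
qed

text \<open>The commutator is a push-forward of the translation defect, and each of the two cuts by
  \<open>proj e\<close> costs a factor \<open>proj_bound\<close>.\<close>

lemma l1norm_diag_at_commutator:
  assumes s: "e * rng s = e"
  shows "l1norm (lact (delta s) (diag_at e p) - ract (diag_at e p) (delta s)) \<le>
    proj_bound\<^sup>2 * l1norm (push (\<lambda>h. e * s * h) p - p)"
proof -
  let ?P = "proj e"
  define d where "d = push (\<lambda>h. e * s * h) p - p"
  define k where "k = push (\<lambda>h. (h, star h * (e * s))) d"
  have es: "rng (e * s) = e" using s by (simp add: rng_mult rng_of_idem e)
  have d: "d \<in> l1" unfolding d_def using p(1) by simp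
  then have k: "k \<in> l1" "l1norm k \<le> l1norm d" unfolding k_def by (simp_all add: l1norm_push)
  have "lact (delta s) (diag_at e p) - ract (diag_at e p) (delta s) = lact ?P (ract k ?P)"
    using s unfolding diag_at_commutator group_diag_commutator[OF es] k_def d_def by simp
  then have "l1norm (lact (delta s) (diag_at e p) - ract (diag_at e p) (delta s)) =
      l1norm (lact ?P (ract k ?P))"
    by (simp only:)
  also have "\<dots> \<le> l1norm ?P * l1norm (ract k ?P)"
    using k(1) by (intro l1norm_lact ract_l1 proj_l1)
  also have "\<dots> \<le> l1norm ?P * (l1norm k * l1norm ?P)"
    using k(1) by (intro mult_left_mono l1norm_ract proj_l1 l1norm_nonneg)
  also have "\<dots> \<le> proj_bound * (l1norm d * proj_bound)"
    using l1norm_proj[OF e] k(2) proj_bound_nonneg by (intro mult_mono) simp_all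
  finally show ?thesis by (simp add: d_def power2_eq_square mult_ac)
qed

end

end

section \<open>Construction of the approximate diagonal\<close>

context ulf_clifford
begin

text \<open>Smallness on \<open>K\<close> comes with bounds that depend neither on \<open>s\<close>
  nor on \<open>K\<close>; both are needed to pass from point masses to all of
  \<open>l1\<close>.\<close>

lemma almost_diagonal:
  fixes K :: "'a set" and \<eta> :: real
  assumes biproj: "approx_left_character_biprojective star"
    and K: "finite K" and \<eta>: "\<eta> > 0"
  obtains m where "m \<in> l1"
    "\<And>s. l1norm (lact (delta s) m - ract m (delta s)) \<le> real N * (2 * proj_bound\<^sup>2)"
    "\<And>s. s \<in> K \<Longrightarrow> l1norm (lact (delta s) m - ract m (delta s)) \<le> \<eta>"
    "\<And>s. l1norm (conv (diag_pi m) (delta s) - delta s) \<le> real N * proj_bound + 1"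
    "\<And>s. s \<in> K \<Longrightarrow> l1norm (conv (diag_pi m) (delta s) - delta s) \<le> 0"
proof -
  \<comment> \<open>At most \<open>N\<close> summands act on a given point mass, each with factor
    \<open>proj_bound\<^sup>2\<close>; the added \<open>1\<close> keeps the denominator
    positive.\<close>
  define \<epsilon> where "\<epsilon> = \<eta> / (real N * proj_bound\<^sup>2 + 1)"
  have c: "0 < real N * proj_bound\<^sup>2 + 1"
    using zero_le_power2[of proj_bound] by (simp add: add_nonneg_pos)
  then have \<epsilon>: "\<epsilon> > 0" using \<eta> by (simp add: \<epsilon>_def)
  have \<epsilon>\<eta>: "real N * (proj_bound\<^sup>2 * \<epsilon>) \<le> \<eta>"
    using c \<eta> by (simp add: \<epsilon>_def field_simps)
  \<comment> \<open>With all of \<open>below (rng s)\<close> included, the projections relevant to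
    \<open>s \<in> K\<close> add up to exactly \<open>delta (rng s)\<close>.\<close>
  define U where "U = (\<Union>s\<in>K. below (rng s))"
  have U: "finite U" unfolding U_def using K finite_below rng_idem by simp
  have U_idem: "e * e = e" if "e \<in> U" for e using that by (auto simp: U_def below_def)
  let ?Q = "\<lambda>e p. p \<in> l1 \<and> (\<forall>h. p h \<noteq> 0 \<longrightarrow> rng h = e) \<and> infsum p UNIV = 1 \<and> l1norm p = 1 \<and>
      (\<forall>s\<in>K. e * rng s = e \<longrightarrow> l1norm (push (\<lambda>h. e * s * h) p - p) < \<epsilon>)"
  have "\<exists>p. ?Q e p" if "e \<in> U" for e
  proof -
    have e: "e * e = e" using that by (rule U_idem)
    have "character (weighted_sum (above_ind e))"
      using e by (intro character_weighted_sum[OF norm_above_ind above_ind_mult, of _ e])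
        (simp add: above_ind_def rng_of_idem)
    then have bip: "approx_left_phi_biprojective (weighted_sum (above_ind e))"
      using biproj unfolding approx_left_character_biprojective_def by blast
    \<comment> \<open>These are the elements of the group at \<open>e\<close> through which the
      members of \<open>K\<close> act on the summand at \<open>e\<close>.\<close>
    let ?K = "(\<lambda>s. e * s) ` {s\<in>K. e * rng s = e}"
    have fin: "finite ?K" using K by simp
    have K': "rng g = e" if "g \<in> ?K" for g
      using that e by (auto simp: rng_mult rng_of_idem)
    show ?thesis
    proof (rule reiter_condition[OF bip e fin K' \<epsilon>])
      fix p :: "'a \<Rightarrow> complex"
      assume "p \<in> l1" "\<And>h. p h \<noteq> 0 \<Longrightarrow> rng h = e" "infsum p UNIV = 1" "l1norm p = 1"
        "\<And>g. g \<in> ?K \<Longrightarrow> l1norm (push (\<lambda>h. g * h) p - p) < \<epsilon>"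
      then show ?thesis by (intro exI[of _ p]) auto
    qed
  qed
  then have "\<forall>e\<in>U. \<exists>p. ?Q e p" by (rule ballI)
  from bchoice[OF this] obtain p where Q: "\<forall>e\<in>U. ?Q e (p e)" ..
  have p: "\<And>e. e \<in> U \<Longrightarrow> p e \<in> l1" "\<And>e h. e \<in> U \<Longrightarrow> p e h \<noteq> 0 \<Longrightarrow> rng h = e"
    "\<And>e. e \<in> U \<Longrightarrow> infsum (p e) UNIV = 1" "\<And>e. e \<in> U \<Longrightarrow> l1norm (p e) = 1"
    "\<And>e s. e \<in> U \<Longrightarrow> s \<in> K \<Longrightarrow> e * rng s = e \<Longrightarrow> l1norm (push (\<lambda>h. e * s * h) (p e) - p e) < \<epsilon>"
    using Q by simp_all
  define M where "M e = diag_at e (p e)" for e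
  define m where "m = (\<Sum>e\<in>U. M e)"
  have M: "M e \<in> l1" if "e \<in> U" for e
    unfolding M_def using diag_at_l1[OF U_idem[OF that] p(1,2,3,4)[OF that]] that by blast
  have m: "m \<in> l1" unfolding m_def by (intro l1_sum M)
  define A where "A s = U \<inter> below (rng s)" for s
  have A: "finite (A s)" "card (A s) \<le> N" for s
    using finite_below[OF rng_idem[of s]] card_below[OF rng_idem[of s]]
      card_mono[of "below (rng s)" "A s"] by (auto simp: A_def)
  have A_iff: "e \<in> A s \<longleftrightarrow> e \<in> U \<and> e * rng s = e" for e s
    using U_idem[of e] by (auto simp: A_def below_def)
  have sum_A: "(\<Sum>e\<in>U. f e) = (\<Sum>e\<in>A s. f e)"
    if "\<And>e. e \<in> U \<Longrightarrow> e * rng s \<noteq> e \<Longrightarrow> f e = 0" for f :: "'a \<Rightarrow> 'b \<Rightarrow> complex" and s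
    using U that A_iff by (intro sum.mono_neutral_right) auto
  have comm: "l1norm (lact (delta s) m - ract m (delta s)) \<le> real N * C"
    if C: "0 \<le> C" "\<And>e. e \<in> A s \<Longrightarrow> proj_bound\<^sup>2 * l1norm (push (\<lambda>h. e * s * h) (p e) - p e) \<le> C" for C s
  proof -
    let ?d = "\<lambda>e. lact (delta s) (M e) - ract (M e) (delta s)"
    have "lact (delta s) m - ract m (delta s) = (\<Sum>e\<in>U. ?d e)"
      unfolding m_def sum_subtractf
      using bounded_linear_l1_sum[OF bounded_linear_l1_lact_right[OF delta_l1[of s]], of U M] M
        bounded_linear_l1_sum[OF bounded_linear_l1_ract_left[OF delta_l1[of s]], of U M] by simp
    also have "\<dots> = (\<Sum>e\<in>A s. ?d e)"
    proof (rule sum_A)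
      fix e assume e: "e \<in> U" "e * rng s \<noteq> e"
      show "?d e = 0"
        unfolding M_def
        using diag_at_commutator[OF U_idem[OF e(1)] p(1,2,3,4)[OF e(1)], of s] e by simp
    qed
    finally have eq: "lact (delta s) m - ract m (delta s) = (\<Sum>e\<in>A s. ?d e)" .
    have "l1norm (\<Sum>e\<in>A s. ?d e) \<le> (\<Sum>e\<in>A s. l1norm (?d e))"
      by (intro l1norm_sum l1_diff lact_l1 ract_l1 M delta_l1) (auto simp: A_iff)
    also have "\<dots> \<le> (\<Sum>e\<in>A s. C)"
    proof (rule sum_mono)
      fix e assume e: "e \<in> A s"
      then have e': "e \<in> U" "e * rng s = e" by (auto simp: A_iff)
      show "l1norm (?d e) \<le> C"
        unfolding M_def
        using l1norm_diag_at_commutator[OF U_idem[OF e'(1)] p(1,2,3,4)[OF e'(1)] e'(2)] C(2)[OF e] e'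
        by fastforce
    qed
    also have "\<dots> \<le> real N * C"
      using A(2)[of s] C(1) by (simp add: mult_right_mono)
    finally show ?thesis unfolding eq .
  qed
  have diag_m: "diag_pi m = (\<Sum>e\<in>U. proj e)"
  proof -
    have "diag_pi (M e) = proj e" if "e \<in> U" for e
      unfolding M_def using diag_pi_diag_at[OF U_idem[OF that] p(1,2,3,4)[OF that]] that by blast
    then have "(\<Sum>e\<in>U. diag_pi (M e)) = (\<Sum>e\<in>U. proj e)"
      by (rule sum.cong[OF refl])
    moreover have "diag_pi m = (\<Sum>e\<in>U. diag_pi (M e))"
      unfolding m_def diag_pi_push by (rule bounded_linear_l1_sum[OF bounded_linear_l1_push M])
    ultimately show ?thesis by (simp only:)
  qed
  have diag_conv: "conv (diag_pi m) (delta s) = (\<Sum>e\<in>A s. conv (proj e) (delta s))" for s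
  proof -
    have "conv (diag_pi m) (delta s) = (\<Sum>e\<in>U. conv (proj e) (delta s))"
      unfolding diag_m by (simp add: conv_sum_left)
    also have "\<dots> = (\<Sum>e\<in>A s. conv (proj e) (delta s))"
      by (rule sum_A) (use proj_conv_delta[OF U_idem] in simp)
    finally show ?thesis .
  qed
  show ?thesis
  proof (rule that[OF m])
    fix s
    show "l1norm (lact (delta s) m - ract m (delta s)) \<le> real N * (2 * proj_bound\<^sup>2)"
    proof (rule comm)
      fix e assume "e \<in> A s"
      then have e: "e \<in> U" by (simp add: A_iff)
      have "l1norm (push (\<lambda>h. e * s * h) (p e) - p e) \<le> l1norm (push (\<lambda>h. e * s * h) (p e)) + l1norm (p e)"
        by (intro l1norm_diff push_l1 p(1) e)
      also have "\<dots> \<le> 2" using l1norm_push[OF p(1)[OF e], of "\<lambda>h. e * s * h"] p(4)[OF e] by simp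
      finally show "proj_bound\<^sup>2 * l1norm (push (\<lambda>h. e * s * h) (p e) - p e) \<le> 2 * proj_bound\<^sup>2"
        by (simp add: mult.commute[of 2] mult_left_mono)
    qed simp
    have "l1norm (conv (diag_pi m) (delta s)) \<le> (\<Sum>e\<in>A s. l1norm (conv (proj e) (delta s)))"
      unfolding diag_conv by (intro l1norm_sum) simp
    also have "\<dots> \<le> (\<Sum>e\<in>A s. proj_bound)"
    proof (rule sum_mono)
      fix e assume "e \<in> A s"
      then have "e * e = e" using U_idem by (simp add: A_iff)
      then show "l1norm (conv (proj e) (delta s)) \<le> proj_bound"
        using l1norm_conv[of "proj e" "delta s"] l1norm_proj[of e] by simp
    qed
    also have "\<dots> \<le> real N * proj_bound"
      using A(2)[of s] proj_bound_nonneg by (simp add: mult_right_mono)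
    finally have "l1norm (conv (diag_pi m) (delta s)) \<le> real N * proj_bound" .
    moreover have "l1norm (conv (diag_pi m) (delta s) - delta s) \<le>
        l1norm (conv (diag_pi m) (delta s)) + l1norm (delta s)"
      using m by (intro l1norm_diff conv_l1 diag_pi_l1 delta_l1)
    ultimately show "l1norm (conv (diag_pi m) (delta s) - delta s) \<le> real N * proj_bound + 1"
      by simp
  next
    fix s assume s: "s \<in> K"
    have "l1norm (lact (delta s) m - ract m (delta s)) \<le> real N * (proj_bound\<^sup>2 * \<epsilon>)"
    proof (rule comm)
      fix e assume "e \<in> A s"
      then have "l1norm (push (\<lambda>h. e * s * h) (p e) - p e) \<le> \<epsilon>"
        using p(5)[of e s] s by (simp add: A_iff)
      then show "proj_bound\<^sup>2 * l1norm (push (\<lambda>h. e * s * h) (p e) - p e) \<le> proj_bound\<^sup>2 * \<epsilon>"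
        by (simp add: mult_left_mono)
    qed (use \<epsilon> in simp)
    with \<epsilon>\<eta> show "l1norm (lact (delta s) m - ract m (delta s)) \<le> \<eta>" by linarith
    \<comment> \<open>For \<open>s \<in> K\<close> no idempotent below \<open>rng s\<close> is
      missing, so \<open>diag_pi m\<close> fixes \<open>delta s\<close> exactly.\<close>
    have "A s = below (rng s)" using s by (auto simp: A_def U_def)
    then have "conv (diag_pi m) (delta s) = conv (\<Sum>e\<in>below (rng s). proj e) (delta s)"
      unfolding diag_conv by (simp add: conv_sum_left)
    then have "conv (diag_pi m) (delta s) = delta s"
      by (simp add: sum_proj[OF rng_idem])
    then show "l1norm (conv (diag_pi m) (delta s) - delta s) \<le> 0" by simp
  qed
qed

lemma approx_left_character_biprojective_imp_pseudo_amenable: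
  assumes "approx_left_character_biprojective star"
  shows "pseudo_amenable star"
proof -
  define D1 where "D1 = real N * (2 * proj_bound\<^sup>2)"
  define D2 where "D2 = real N * proj_bound + 1"
  \<comment> \<open>An index is a set with a precision. The guard makes infinite sets vacuous; they
    are negligible for the filter \<open>I\<close>.\<close>
  let ?Q = "\<lambda>(i :: 'a set \<times> nat) m. finite (fst i) \<longrightarrow> m \<in> l1 \<and>
      (\<forall>s. l1norm (lact (delta s) m - ract m (delta s)) \<le> D1) \<and>
      (\<forall>s\<in>fst i. l1norm (lact (delta s) m - ract m (delta s)) \<le> inverse (real (Suc (snd i)))) \<and>
      (\<forall>s. l1norm (conv (diag_pi m) (delta s) - delta s) \<le> D2) \<and>
      (\<forall>s\<in>fst i. l1norm (conv (diag_pi m) (delta s) - delta s) \<le> 0)"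
  have "\<exists>m. ?Q i m" for i :: "'a set \<times> nat"
  proof (cases "finite (fst i)")
    case True
    show ?thesis
      by (rule almost_diagonal[OF assms True, of "inverse (real (Suc (snd i)))"])
        (auto simp: D1_def D2_def)
  qed simp
  then have "\<forall>i. \<exists>m. ?Q i m" by (rule allI)
  from choice[OF this] obtain m where Q: "\<forall>i. ?Q i (m i)" ..
  have m: "\<And>i. finite (fst i) \<Longrightarrow> m i \<in> l1"
    "\<And>i s. finite (fst i) \<Longrightarrow> l1norm (lact (delta s) (m i) - ract (m i) (delta s)) \<le> D1"
    "\<And>i s. finite (fst i) \<Longrightarrow> s \<in> fst i \<Longrightarrow>
        l1norm (lact (delta s) (m i) - ract (m i) (delta s)) \<le> inverse (real (Suc (snd i)))"
    "\<And>i s. finite (fst i) \<Longrightarrow> l1norm (conv (diag_pi (m i)) (delta s) - delta s) \<le> D2"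
    "\<And>i s. finite (fst i) \<Longrightarrow> s \<in> fst i \<Longrightarrow> l1norm (conv (diag_pi (m i)) (delta s) - delta s) \<le> 0"
    using Q by blast+
  define I where "I = finite_subsets_at_top (UNIV :: 'a set) \<times>\<^sub>F (sequentially :: nat filter)"
  define F where "F = filtermap m I"
  have fin: "\<forall>\<^sub>F i in I. finite (fst i)"
    unfolding I_def
    by (rule eventually_compose_filterlim[OF eventually_finite_subsets_at_top_weakI filterlim_fst]) simp
  \<comment> \<open>The mass of \<open>a\<close> outside the finite set vanishes in the limit, which
    absorbs the uniform constants \<open>D1\<close> and \<open>D2\<close>.\<close>
  have tail: "((\<lambda>i. infsum (\<lambda>s. norm (a s)) (- fst i)) \<longlongrightarrow> 0) I" if a: "a \<in> l1" for a :: "'a \<Rightarrow> complex"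
  proof -
    let ?a = "\<lambda>s. norm (a s)"
    have "(sum ?a \<longlongrightarrow> infsum ?a UNIV) (finite_subsets_at_top UNIV)"
      by (intro infsum_tendsto l1D a)
    then have "((\<lambda>i. sum ?a (fst i)) \<longlongrightarrow> infsum ?a UNIV) I"
      unfolding I_def by (rule filterlim_compose[OF _ filterlim_fst])
    then have "((\<lambda>i. infsum ?a UNIV - sum ?a (fst i)) \<longlongrightarrow> infsum ?a UNIV - infsum ?a UNIV) I"
      by (intro tendsto_intros)
    moreover have "\<forall>\<^sub>F i in I. infsum ?a UNIV - sum ?a (fst i) = infsum ?a (- fst i)"
      using fin
    proof eventually_elim
      case (elim i)
      then show ?case
        using infsum_Un_disjoint[of ?a "fst i" "- fst i"] l1D[OF a] by auto
    qed
    ultimately show ?thesis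
      using Lim_transform_eventually by fastforce
  qed
  have inv: "((\<lambda>i. inverse (real (Suc (snd i)))) \<longlongrightarrow> 0) I"
    unfolding I_def by (rule filterlim_compose[OF LIMSEQ_inverse_real_of_nat filterlim_snd])
  have comm: "((\<lambda>m. l1norm (lact a m - ract m a)) \<longlongrightarrow> 0) F" if a: "a \<in> l1" for a
  proof -
    let ?b = "\<lambda>i. inverse (real (Suc (snd i))) * l1norm a + D1 * infsum (\<lambda>s. norm (a s)) (- fst i)"
    have "\<forall>\<^sub>F i in I. norm (l1norm (lact a (m i) - ract (m i) a)) \<le> ?b i"
      using fin
    proof eventually_elim
      case (elim i)
      let ?m = "m i"
      have "bounded_linear_l1 (\<lambda>a. lact a ?m - ract ?m a)"
        by (intro bounded_linear_l1_diff bounded_linear_l1_lact_left bounded_linear_l1_ract_right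
            m elim)
      from l1norm_bounded_linear_split[OF this a, of "fst i", OF m(3)[OF elim] _ m(2)[OF elim]]
      have "l1norm (lact a ?m - ract ?m a) \<le> ?b i" by simp
      then show ?case by (simp only: real_norm_def abs_of_nonneg l1norm_nonneg)
    qed
    moreover have "(?b \<longlongrightarrow> 0 * l1norm a + D1 * 0) I"
      by (intro tendsto_intros inv tail a)
    then have "(?b \<longlongrightarrow> 0) I" by (simp only: mult_zero_left mult_zero_right add_0_left)
    ultimately have "((\<lambda>i. l1norm (lact a (m i) - ract (m i) a)) \<longlongrightarrow> 0) I"
      by (rule Lim_null_comparison)
    then show ?thesis unfolding F_def by (simp add: filterlim_filtermap case_prod_unfold)
  qed
  have unit: "((\<lambda>m. l1norm (conv (diag_pi m) a - a)) \<longlongrightarrow> 0) F" if a: "a \<in> l1" for a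
  proof -
    \<comment> \<open>No precision term appears, because the error at point masses of the finite set
      is exactly zero.\<close>
    let ?b = "\<lambda>i. D2 * infsum (\<lambda>s. norm (a s)) (- fst i)"
    have "\<forall>\<^sub>F i in I. norm (l1norm (conv (diag_pi (m i)) a - a)) \<le> ?b i"
      using fin
    proof eventually_elim
      case (elim i)
      let ?m = "m i"
      have "bounded_linear_l1 (\<lambda>a :: 'a \<Rightarrow> complex. a)"
        by (rule bounded_linear_l1I[where C = 1]) simp_all
      then have "bounded_linear_l1 (\<lambda>a. conv (diag_pi ?m) a - a)"
        by (intro bounded_linear_l1_diff bounded_linear_l1_conv_right diag_pi_l1 m elim)
      from l1norm_bounded_linear_split[OF this a, of "fst i", OF m(5)[OF elim] _ m(4)[OF elim]]
      have "l1norm (conv (diag_pi ?m) a - a) \<le> ?b i" by simp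
      then show ?case by (simp only: real_norm_def abs_of_nonneg l1norm_nonneg)
    qed
    moreover have "(?b \<longlongrightarrow> D2 * 0) I"
      by (intro tendsto_intros tail a)
    then have "(?b \<longlongrightarrow> 0) I" by (simp only: mult_zero_right)
    ultimately have "((\<lambda>i. l1norm (conv (diag_pi (m i)) a - a)) \<longlongrightarrow> 0) I"
      by (rule Lim_null_comparison)
    then show ?thesis unfolding F_def by (simp add: filterlim_filtermap case_prod_unfold)
  qed
  have "F \<noteq> bot"
    unfolding F_def I_def by (simp add: filtermap_bot_iff prod_filter_eq_bot)
  moreover have "\<forall>\<^sub>F m in F. m \<in> l1"
    unfolding F_def eventually_filtermap using fin by eventually_elim (auto intro: m)
  ultimately show ?thesis
    unfolding pseudo_amenable_def using comm unit unfolding fun_diff_def by blast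
qed

end

theorem theorem3p8:
  fixes star :: "'a::semigroup_mult \<Rightarrow> 'a"
  assumes "clifford_semigroup star"
    and "uniformly_locally_finite star"
  shows "approx_left_character_biprojective star \<longleftrightarrow> pseudo_amenable star"
proof
  interpret clifford star by unfold_locales (rule assms(1))
  obtain N where N: "\<forall>x\<in>idempotents. finite (down_set star x) \<and> card (down_set star x) \<le> N"
    using assms(2) unfolding uniformly_locally_finite_def by blast
  interpret ulf_clifford star N
    using N down_set_idem by unfold_locales (auto simp: idempotents_def)
  show "pseudo_amenable star" if "approx_left_character_biprojective star"
    using that by (rule approx_left_character_biprojective_imp_pseudo_amenable)
next
  assume "pseudo_amenable star"
  then show "approx_left_character_biprojective star"
    unfolding approx_left_character_biprojective_def
    using pseudo_amenable_imp_approx_left_phi_biprojective by blast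
qed

end
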